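(* Let $K$ be a number field of degree $d$, and let $\phi=(\phi_v)_{v\in S}:[0,1]\to K_S$ be a $C^1$ curve. For $x\in[0,1]$ put $T(x)=\{v\in S:\phi_v'(x)\neq0\}$. Suppose that for all but countably many $x\in[0,1]$, $$\#T(x)_{\mathbb{R}}+2\,\#T(x)_{\mathbb{C}}>\frac d2 .$$ Then $\phi^{-1}(\mathbf{BA}_K)$ is absolute winning (as a subset of the metric space $[0,1]$).
   Context: Number field notation. $K$ is a number field of degree $d$ with ring of integers $\mathcal{O}$; $S$ is the set of all normalized, non-conjugate Archimedean valuations of $K$ (one for each real embedding and one for each conjugate pair of complex embeddings). For $v\in S$, $K_v\cong\mathbb{R}$ or $\mathbb{C}$ is the completion with its usual absolute value $|\cdot|$, and $\iota_v:K\to K_v$ is the embedding. $K_S=\prod_{v\in S}K_v\cong\mathbb{R}^d$, with coordinatewise multiplication and norm $\|\mathbf{x}\|=\max_{v\in S}|x_v|$, and $\iota_S:K\to K_S$, $r\mapsto(\iota_v(r))_{v\in S}$. An element $\mathbf{x}\in K_S$ is badly approximable if there is $c>0$ such that $\|\iota_S(q)\cdot\mathbf{x}+\iota_S(p)\|>c\,\|\iota_S(q)\|^{-1}$ for all $p\in\mathcal{O}$, $q\in\mathcal{O}\smallsetminus\{0\}$; $\mathbf{BA}_K$ is the set of all such $\mathbf{x}$. For $T\subseteq S$, $T_{\mathbb{R}}=\{v\in T:K_v\cong\mathbb{R}\}$ and $T_{\mathbb{C}}=\{v\in T:K_v\cong\mathbb{C}\}$. The $\mathcal{H}$-absolute game.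 Let $(X,\mathrm{dist})$ be a complete metric space, $\mathcal{H}$ a non-empty collection of closed subsets of $X$, $Y\subseteq X$ non-empty closed, $0<\beta<1$. A formal ball is a pair $B=(x,\rho)\in X\times\mathbb{R}_{>0}$, with associated closed ball $\mathbf{B}(B)=\{y\in X:\mathrm{dist}(x,y)\le\rho\}$; write $(x_1,\rho_1)\preceq(x_2,\rho_2)$ iff $\mathrm{dist}(x_1,x_2)\le\rho_2-\rho_1$. In the $(\mathcal{H},\beta)$-absolute game on $Y$, Bob and Alice alternately choose $B_1,A_1,B_2,A_2,\dots$ such that: Bob chooses $B_n=(c_n,r_n)\in Y\times\mathbb{R}_{>0}$; Alice chooses $A_n=(\mathcal{L}_n,\rho_n)\in\mathcal{H}\times\mathbb{R}_{>0}$ with $0<\rho_n\le\beta r_n$; $\beta r_n\le r_{n+1}\le r_n$ and $B_{n+1}\preceq B_n$; and $\mathrm{dist}(c_{n+1},\mathcal{L}_n)>\rho_n+r_{n+1}$. If at some stage Bob has no choice of $B_{n+1}$ satisfying these conditions, the game ends and Bob wins. $W\subseteq X$ is $(\mathcal{H},\beta)$-absolute winning on $Y$ if Alice has a strategy ensuring that Bob always has at least one choice at every stage and that $W\cap Y\cap\bigcap_{n\ge1}\mathbf{B}(B_n)\ne\varnothing$ regardless of Bob's strategy. $W$ is $\mathcal{H}$-absolute winning on $Y$ if there is $\beta_0>0$ such that $W$ is $(\mathcal{H},\beta)$-absolute winning on $Y$ for all $0<\beta<\beta_0$. When $Y=X$, the words "on $Y$" are dropped. "Absolute winning" means $\mathcal{H}$-absolute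 winning for $\mathcal{H}=\{\{x\}:x\in X\}$, the collection of singletons of $X$ (McMullen's absolute game). Here $X=Y=[0,1]$ with the usual metric and $\mathcal{H}=\{\{t\}:0\le t\le1\}$.
   Formalization: Bob's first ball must leave at least one legal pair (Alice's move, Bob's reply); with any positive radius allowed, Bob could open on [0,1] with radius 1/β, have no second move, and win, so no set would be absolute winning. *)

theory Defs
  imports "HOL-Analysis.Analysis" "HOL-Computational_Algebra.Polynomial"
begin

definition number_field :: "'k::field_char_0 itself \<Rightarrow> bool" where
  "number_field _ \<longleftrightarrow>
     (\<exists>B. finite B \<and> module.span (\<lambda>(q::rat) (x::'k). of_rat q * x) B = UNIV)"

definition number_field_degree :: "'k::field_char_0 itself \<Rightarrow> nat" where
  "number_field_degree _ = vector_space.dim (\<lambda>(q::rat) (x::'k). of_rat q * x) (UNIV :: 'k set)"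

definition ring_of_integers :: "'k::field_char_0 set" where
  "ring_of_integers = {x. algebraic_int x}"

definition complex_embeddings :: "('k::field_char_0 \<Rightarrow> complex) set" where
  "complex_embeddings = {\<sigma>. \<sigma> 1 = 1 \<and> (\<forall>x y. \<sigma> (x + y) = \<sigma> x + \<sigma> y) \<and> (\<forall>x y. \<sigma> (x * y) = \<sigma> x * \<sigma> y)}"

text \<open>A place is a function \<open>v :: 'k \<Rightarrow> real\<close>, namely the absolute value on the field obtained by
  restricting the usual one along an embedding into the complex numbers. Two embeddings give the
  same place exactly if they are equal or complex conjugate; see \<open>place_eq_iff\<close> below.\<close>

definition archimedean_places :: "('k::field_char_0 \<Rightarrow> real) set" where
  "archimedean_places = (\<lambda>\<sigma> x. cmod (\<sigma> x)) ` complex_embeddings"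

lemma place_eq_iff:
  fixes \<sigma> \<tau> :: "'k::field_char_0 \<Rightarrow> complex"
  assumes "\<sigma> \<in> complex_embeddings" "\<tau> \<in> complex_embeddings"
  shows "(\<lambda>x. cmod (\<sigma> x)) = (\<lambda>x. cmod (\<tau> x)) \<longleftrightarrow> \<tau> = \<sigma> \<or> \<tau> = (\<lambda>x. cnj (\<sigma> x))"
proof
  assume "\<tau> = \<sigma> \<or> \<tau> = (\<lambda>x. cnj (\<sigma> x))"
  then show "(\<lambda>x. cmod (\<sigma> x)) = (\<lambda>x. cmod (\<tau> x))" by auto
next
  assume "(\<lambda>x. cmod (\<sigma> x)) = (\<lambda>x. cmod (\<tau> x))"
  then have eq: "cmod (\<sigma> x) = cmod (\<tau> x)" for x by metis
  have hom: "\<sigma> 1 = 1" "\<sigma> (x + y) = \<sigma> x + \<sigma> y" "\<sigma> (x * y) = \<sigma> x * \<sigma> y"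
            "\<tau> 1 = 1" "\<tau> (x + y) = \<tau> x + \<tau> y" "\<tau> (x * y) = \<tau> x * \<tau> y" for x y
    using assms by (auto simp: complex_embeddings_def)
  have Re_eq: "Re (\<sigma> x) = Re (\<tau> x)" for x
  proof -
    have "(cmod (\<sigma> x + 1))\<^sup>2 = (cmod (\<tau> x + 1))\<^sup>2" using eq[of "x + 1"] by (simp add: hom)
    moreover have "(cmod (\<sigma> x))\<^sup>2 = (cmod (\<tau> x))\<^sup>2" using eq[of x] by simp
    ultimately show ?thesis unfolding cmod_power2 by (simp add: power2_eq_square algebra_simps)
  qed
  have Im_prod: "Im (\<sigma> x) * Im (\<sigma> y) = Im (\<tau> x) * Im (\<tau> y)" for x y
    using Re_eq[of "x * y"] Re_eq[of x] Re_eq[of y] by (simp add: hom)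
  show "\<tau> = \<sigma> \<or> \<tau> = (\<lambda>x. cnj (\<sigma> x))"
  proof (cases "\<exists>a. Im (\<sigma> a) \<noteq> 0")
    case False
    then have "Im (\<tau> x) = 0" for x using Im_prod[of x x] by simp
    then have "\<tau> = \<sigma>" using False Re_eq by (auto simp: complex_eq_iff)
    then show ?thesis ..
  next
    case True
    then obtain a where a: "Im (\<sigma> a) \<noteq> 0" ..
    have "(Im (\<sigma> a))\<^sup>2 = (Im (\<tau> a))\<^sup>2" using Im_prod[of a a] by (simp add: power2_eq_square)
    then consider "Im (\<tau> a) = Im (\<sigma> a)" | "Im (\<tau> a) = - Im (\<sigma> a)"
      by (metis power2_eq_iff minus_minus)
    then show ?thesis
    proof cases
      case 1
      then have "Im (\<tau> x) = Im (\<sigma> x)" for x using Im_prod[of a x] a by simp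
      then have "\<tau> = \<sigma>" using Re_eq by (auto simp: complex_eq_iff)
      then show ?thesis ..
    next
      case 2
      then have "Im (\<tau> x) = - Im (\<sigma> x)" for x
        using Im_prod[of a x] a by (metis minus_mult_commute mult_cancel_left minus_minus)
      then have "\<tau> = (\<lambda>x. cnj (\<sigma> x))" using Re_eq by (auto simp: complex_eq_iff)
      then show ?thesis ..
    qed
  qed
qed

text \<open>A choice of \<open>\<iota>\<close> fixes, for every place \<open>v\<close>, an identification of the completion at \<open>v\<close> with the
  real or the complex numbers. The only freedom is complex conjugation at the complex places.\<close>

definition place_embeddings :: "(('k::field_char_0 \<Rightarrow> real) \<Rightarrow> 'k \<Rightarrow> complex) \<Rightarrow> bool" where
  "place_embeddings \<iota> \<longleftrightarrow>
     (\<forall>v\<in>archimedean_places. \<iota> v \<in> complex_embeddings \<and> (\<forall>r. cmod (\<iota> v r) = v r))"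

text \<open>The completion at \<open>v\<close> is realised as the closure of the image of \<open>\<iota> v\<close> in the complex plane,
  so it is \<open>\<real>\<close> if that image is real and everything otherwise.\<close>

definition completion ::
    "(('k::field_char_0 \<Rightarrow> real) \<Rightarrow> 'k \<Rightarrow> complex) \<Rightarrow> ('k \<Rightarrow> real) \<Rightarrow> complex set" where
  "completion \<iota> v = closure (range (\<iota> v))"

definition real_places ::
    "(('k::field_char_0 \<Rightarrow> real) \<Rightarrow> 'k \<Rightarrow> complex) \<Rightarrow> ('k \<Rightarrow> real) set \<Rightarrow> ('k \<Rightarrow> real) set" where
  "real_places \<iota> T = {v \<in> T. completion \<iota> v = \<real>}"

definition complex_places ::
    "(('k::field_char_0 \<Rightarrow> real) \<Rightarrow> 'k \<Rightarrow> complex) \<Rightarrow> ('k \<Rightarrow> real) set \<Rightarrow> ('k \<Rightarrow> real) set" where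
  "complex_places \<iota> T = {v \<in> T. completion \<iota> v = UNIV}"

definition K_S ::
    "(('k::field_char_0 \<Rightarrow> real) \<Rightarrow> 'k \<Rightarrow> complex) \<Rightarrow> (('k \<Rightarrow> real) \<Rightarrow> complex) set" where
  "K_S \<iota> = (\<Pi>\<^sub>E v\<in>archimedean_places. completion \<iota> v)"

definition norm_S :: "(('k::field_char_0 \<Rightarrow> real) \<Rightarrow> complex) \<Rightarrow> real" where
  "norm_S x = Max ((\<lambda>v. cmod (x v)) ` archimedean_places)"

definition badly_approximable ::
    "(('k::field_char_0 \<Rightarrow> real) \<Rightarrow> 'k \<Rightarrow> complex) \<Rightarrow> (('k \<Rightarrow> real) \<Rightarrow> complex) set" where
  "badly_approximable \<iota> = {x \<in> K_S \<iota>. \<exists>c>0. \<forall>p\<in>ring_of_integers. \<forall>q\<in>ring_of_integers - {0}.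
     norm_S (\<lambda>v. \<iota> v q * x v + \<iota> v p) > c * inverse (norm_S (\<lambda>v. \<iota> v q))}"


text \<open>The ambient space \<open>X\<close> and the playground \<open>Y \<subseteq> X\<close> are subsets of a metric type; a formal ball
  is a pair of a centre and a radius.\<close>

definition ball_set :: "'a::metric_space set \<Rightarrow> 'a \<times> real \<Rightarrow> 'a set" where
  "ball_set X B = {y \<in> X. dist (fst B) y \<le> snd B}"

definition ball_le :: "'a::metric_space \<times> real \<Rightarrow> 'a \<times> real \<Rightarrow> bool" where
  "ball_le B B' \<longleftrightarrow> dist (fst B) (fst B') \<le> snd B' - snd B"

definition alice_move :: "'a::metric_space set set \<Rightarrow> real \<Rightarrow> 'a \<times> real \<Rightarrow> 'a set \<times> real \<Rightarrow> bool" where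
  "alice_move \<H> \<beta> B A \<longleftrightarrow> fst A \<in> \<H> \<and> 0 < snd A \<and> snd A \<le> \<beta> * snd B"

text \<open>\<open>bob_move Y \<beta> B A B'\<close>: after Bob's ball \<open>B\<close> and Alice's reply \<open>A\<close>, Bob may choose \<open>B'\<close>.\<close>

definition bob_move ::
    "'a::metric_space set \<Rightarrow> real \<Rightarrow> 'a \<times> real \<Rightarrow> 'a set \<times> real \<Rightarrow> 'a \<times> real \<Rightarrow> bool" where
  "bob_move Y \<beta> B A B' \<longleftrightarrow> fst B' \<in> Y \<and> 0 < snd B' \<and>
     \<beta> * snd B \<le> snd B' \<and> snd B' \<le> snd B \<and> ball_le B' B \<and>
     infdist (fst B') (fst A) > snd A + snd B'"

text \<open>In a bounded space, an opening ball whose radius is at least \<open>1 / \<beta>\<close> times the diameter leaves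
  Bob without a second move whatever Alice replies. Read literally, the rule that Bob wins when he
  cannot move would then make every subset of a bounded space fail to be winning. Openings after
  which no pair of further moves exists are therefore not admitted. At all later
  stages it is Alice's task to leave Bob a move.\<close>

definition bob_opening ::
    "'a::metric_space set set \<Rightarrow> 'a set \<Rightarrow> real \<Rightarrow> 'a \<times> real \<Rightarrow> bool" where
  "bob_opening \<H> Y \<beta> B \<longleftrightarrow> fst B \<in> Y \<and> 0 < snd B \<and>
     (\<exists>A B'. alice_move \<H> \<beta> B A \<and> bob_move Y \<beta> B A B')"

text \<open>A strategy \<open>s\<close> of Alice maps the list of Bob's moves so far to her next move; her own earlier
  moves are determined by \<open>s\<close> and that list.\<close>

inductive bob_play ::
    "'a::metric_space set set \<Rightarrow> 'a set \<Rightarrow> real \<Rightarrow> (('a \<times> real) list \<Rightarrow> 'a set \<times> real) \<Rightarrow>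
     ('a \<times> real) list \<Rightarrow> bool"
  for \<H> Y \<beta> s where
  first: "bob_opening \<H> Y \<beta> B \<Longrightarrow> bob_play \<H> Y \<beta> s [B]"
| extend: "bob_play \<H> Y \<beta> s Bs \<Longrightarrow> bob_move Y \<beta> (last Bs) (s Bs) B \<Longrightarrow> bob_play \<H> Y \<beta> s (Bs @ [B])"

definition winning_strategy ::
    "'a::metric_space set \<Rightarrow> 'a set set \<Rightarrow> 'a set \<Rightarrow> real \<Rightarrow> 'a set \<Rightarrow>
     (('a \<times> real) list \<Rightarrow> 'a set \<times> real) \<Rightarrow> bool" where
  "winning_strategy X \<H> Y \<beta> W s \<longleftrightarrow>
     (\<forall>Bs. bob_play \<H> Y \<beta> s Bs \<longrightarrow>
        alice_move \<H> \<beta> (last Bs) (s Bs) \<and> (\<exists>B. bob_move Y \<beta> (last Bs) (s Bs) B)) \<and>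
     (\<forall>B. (\<forall>n. bob_play \<H> Y \<beta> s (map B [0..<Suc n])) \<longrightarrow>
        W \<inter> Y \<inter> (\<Inter>n. ball_set X (B n)) \<noteq> {})"

definition H_absolute_winning_on ::
    "'a::metric_space set \<Rightarrow> 'a set set \<Rightarrow> 'a set \<Rightarrow> 'a set \<Rightarrow> bool" where
  "H_absolute_winning_on X \<H> Y W \<longleftrightarrow>
     (\<exists>\<beta>\<^sub>0>0. \<forall>\<beta>. 0 < \<beta> \<and> \<beta> < 1 \<and> \<beta> < \<beta>\<^sub>0 \<longrightarrow> (\<exists>s. winning_strategy X \<H> Y \<beta> W s))"

definition absolute_winning :: "'a::metric_space set \<Rightarrow> 'a set \<Rightarrow> bool" where
  "absolute_winning X W \<longleftrightarrow> H_absolute_winning_on X ((\<lambda>x. {x}) ` X) X W"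

end

theory Submission
  imports Defs "HOL-Algebra.Algebraic_Closure_Type" "Jordan_Normal_Form.Char_Poly"
begin

hide_const (open) Polynomials.degree up_ring.coeff up_ring.monom Coset.order Polynomials.lead_coeff

text \<open>
  Give a denominator \<open>q\<close> the height \<open>H(q) = |q|\<^sub>S * |q|\<^sub>T\<close>, the product of its largest absolute value over all
  places and its largest absolute value over the set \<open>T\<close> of places in whose direction the curve moves.
  Suppose that \<open>p/q\<close> and \<open>p'/q'\<close> have comparable height \<open>H\<close> and both approximate the curve inside an
  interval of length about \<open>1/H\<close>. With \<open>u = H / (|q|\<^sub>S * |q'|\<^sub>S) \<le> 1\<close>, the algebraic integer
  \<open>q p' - q' p\<close> is at most \<open>e u\<close> at the places of \<open>T\<close> and at most \<open>e / u\<close> elsewhere, for some \<open>e < 1\<close>.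
  As \<open>T\<close> carries at least half of the embeddings, its norm is less than 1, so the two fractions agree.
  The points of the interval approximated at this scale with \<open>q\<close> maximal at a given place \<open>v\<close> of \<open>T\<close>
  therefore cluster at a single point, since the curve expands at \<open>v\<close>. Alice removes these clusters place by
  place in a periodic schedule; spare turns delete the countably many exceptional parameters and the parameters where
  a component meets the field, and force the radii to tend to 0. Which \<open>T\<close> is used is read off from the current
  ball and stabilises eventually.
\<close>

section \<open>Algebraic integers\<close>

text \<open>The height comes from the approximation itself: where |q| attains its maximum over
  \<open>T\<close>, dividing the error bound c/|q|_S by |q| leaves c/H. Two obstacles shape the
  argument. Units: infinitely many denominators may have bounded height, so small heights cannot be
  discarded as a finite set. Instead, all sufficiently good approximations of bounded height
  represent one fraction, and that fraction is harmless unless a component takes a value in the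
  field. Lack of uniformity: during the play Alice knows neither the final parameter nor a lower
  bound for the derivatives there. The expansion constant is therefore a natural number read off
  from the ball, the least one that leaves enough weight. Along nested balls it can only drop, so
  the approximation constant depending on it is eventually fixed, and the turns before that are
  absorbed by the result on bounded heights. The turn of a given place recurs after one period, in
  which the radius shrinks at most by the factor \<beta>^period. Windows of this ratio thus catch
  every large height at some turn of the right place.\<close>

definition int_span :: "'i set \<Rightarrow> ('i \<Rightarrow> 'a::comm_ring_1) \<Rightarrow> 'a set" where
  "int_span I f = {y. \<exists>c. y = (\<Sum>i\<in>I. of_int (c i) * f i)}"

lemma int_span_base:
  assumes "finite I" "i \<in> I"
  shows "f i \<in> int_span I f"
proof -
  have "f i = (\<Sum>j\<in>I. of_int (if j = i then 1 else 0) * f j)"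
    using assms by (simp add: if_distrib[of of_int] if_distrib[of "\<lambda>x. x * _"] sum.delta cong: if_cong)
  then show ?thesis
    unfolding int_span_def by (intro CollectI exI)
qed

lemma int_span_add:
  assumes "y \<in> int_span I f" "z \<in> int_span I f"
  shows "y + z \<in> int_span I f"
proof -
  obtain c d where "y = (\<Sum>i\<in>I. of_int (c i) * f i)" "z = (\<Sum>i\<in>I. of_int (d i) * f i)"
    using assms unfolding int_span_def by blast
  then have "y + z = (\<Sum>i\<in>I. of_int (c i + d i) * f i)"
    by (simp add: sum.distrib algebra_simps)
  then show ?thesis
    unfolding int_span_def by (intro CollectI exI)
qed

lemma int_span_scale:
  assumes "y \<in> int_span I f"
  shows "of_int k * y \<in> int_span I f"
proof -
  obtain c where "y = (\<Sum>i\<in>I. of_int (c i) * f i)"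
    using assms unfolding int_span_def by blast
  then have "of_int k * y = (\<Sum>i\<in>I. of_int (k * c i) * f i)"
    by (simp add: sum_distrib_left algebra_simps)
  then show ?thesis
    unfolding int_span_def by (intro CollectI exI)
qed

lemma int_span_sum:
  assumes "\<And>k. k \<in> K \<Longrightarrow> y k \<in> int_span I f"
  shows "sum y K \<in> int_span I f"
proof -
  have "0 \<in> int_span I f"
    unfolding int_span_def by (auto intro!: exI[of _ "\<lambda>_. 0"])
  with assms show ?thesis
    by (induction K rule: infinite_finite_induct) (auto intro: int_span_add)
qed

text \<open>Stability is known on generators only; extending it to the whole module allows two
  multiplications to be composed.\<close>

lemma int_span_mult:
  assumes "\<And>i. i \<in> I \<Longrightarrow> x * f i \<in> int_span I f" "y \<in> int_span I f"
  shows "x * y \<in> int_span I f"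
proof -
  obtain c where "y = (\<Sum>i\<in>I. of_int (c i) * f i)"
    using assms unfolding int_span_def by blast
  then have "x * y = (\<Sum>i\<in>I. of_int (c i) * (x * f i))"
    by (simp add: sum_distrib_left algebra_simps)
  then show ?thesis
    using assms(1) by (auto intro!: int_span_sum int_span_scale)
qed

text \<open>The matrix of multiplication by \<open>x\<close> on a finitely generated stable \<open>\<int>\<close>-module has \<open>x\<close> as an eigenvalue.\<close>

lemma algebraic_int_if_stable:
  fixes x :: "'a::field_char_0"
  assumes I: "finite I" and stable: "\<And>i. i \<in> I \<Longrightarrow> x * f i \<in> int_span I f"
    and nz: "k \<in> I" "f k \<noteq> 0"
  shows "algebraic_int x"
proof -
  define n where "n = card I"
  obtain g where g: "bij_betw g {..<n} I"
    using ex_bij_betw_nat_finite[OF I] by (auto simp: n_def atLeast0LessThan)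
  have "\<forall>i\<in>I. \<exists>c. x * f i = (\<Sum>j\<in>I. of_int (c j) * f j)"
    using stable unfolding int_span_def by blast
  then obtain c where c: "\<And>i. i \<in> I \<Longrightarrow> x * f i = (\<Sum>j\<in>I. of_int (c i j) * f j)"
    by metis
  define A where "A = Matrix.mat n n (\<lambda>(i, j). c (g i) (g j))"
  define v where "v = Matrix.vec n (\<lambda>i. f (g i))"
  have A: "A \<in> carrier_mat n n" and A': "map_mat of_int A \<in> carrier_mat n n"
    by (auto simp: A_def)
  have gI: "g i \<in> I" if "i < n" for i
    using g that by (auto simp: bij_betw_def)
  have "map_mat of_int A *\<^sub>v v = x \<cdot>\<^sub>v v"
  proof (rule eq_vecI)
    fix i assume "i < dim_vec (x \<cdot>\<^sub>v v)"
    then have i: "i < n" by (simp add: v_def)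
    have "vec_index (map_mat of_int A *\<^sub>v v) i = (\<Sum>j<n. of_int (c (g i) (g j)) * f (g j))"
      using i by (simp add: A_def v_def scalar_prod_def atLeast0LessThan)
    also have "\<dots> = (\<Sum>j\<in>I. of_int (c (g i) j) * f j)"
      by (rule sum.reindex_bij_betw[OF g])
    also have "\<dots> = x * f (g i)"
      using c[OF gI[OF i]] by simp
    finally show "vec_index (map_mat of_int A *\<^sub>v v) i = vec_index (x \<cdot>\<^sub>v v) i"
      using i by (simp add: v_def)
  qed (auto simp: A_def v_def)
  moreover have "v \<noteq> 0\<^sub>v n"
  proof
    assume v0: "v = 0\<^sub>v n"
    obtain i where i: "i < n" "g i = k"
      using g nz(1) by (auto simp: bij_betw_def)
    then have "vec_index v i = f k" by (simp add: v_def)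
    then show False using v0 nz(2) i by simp
  qed
  ultimately have "eigenvalue (map_mat of_int A) x"
    unfolding eigenvalue_def eigenvector_def using A by (auto simp: v_def intro!: exI[of _ v])
  then have "poly (char_poly (map_mat of_int A)) x = 0"
    using eigenvalue_root_char_poly[OF A'] by blast
  \<comment> \<open>Integer entries make this the image of an integer polynomial, and characteristic
    polynomials are monic.\<close>
  then have "poly (map_poly of_int (char_poly A)) x = 0"
    by (simp add: of_int_hom.char_poly_hom[OF A])
  moreover have "lead_coeff (char_poly A) = 1"
    using degree_monic_char_poly[OF A] by simp
  ultimately show ?thesis
    unfolding algebraic_int_altdef_ipoly by blast
qed

text \<open>A monic relation expresses the top power through lower ones without division. A monic
  constant has no root, whence \<open>m > 0\<close>, which keeps the exponent 0 available.\<close>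

lemma algebraic_int_power_reduce:
  fixes a :: "'a::field_char_0"
  assumes "algebraic_int a"
  obtains m c where "m > 0" "a ^ m = (\<Sum>i<m. of_int (c i) * a ^ i)"
proof -
  obtain p where p: "poly (map_poly of_int p) a = 0" "lead_coeff p = 1"
    using assms unfolding algebraic_int_altdef_ipoly by blast
  have "0 = (\<Sum>i\<le>degree p. of_int (coeff p i) * a ^ i)"
    using p(1) by (simp add: poly_altdef)
  also have "\<dots> = (\<Sum>i<degree p. of_int (coeff p i) * a ^ i) + a ^ degree p"
    using p(2) by (simp flip: lessThan_Suc_atMost)
  finally have "a ^ degree p = (\<Sum>i<degree p. of_int (- coeff p i) * a ^ i)"
    by (simp add: sum_negf eq_neg_iff_add_eq_0 add.commute)
  moreover have "degree p > 0"
    using p by (cases "degree p = 0") (auto elim!: degree_eq_zeroE)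
  ultimately show ?thesis
    using that[of "degree p" "\<lambda>i. - coeff p i"] by blast
qed

text \<open>The monomials \<open>a ^ i * b ^ j\<close> with \<open>i < m\<close> and
  \<open>j < n\<close> generate a module stable under both multiplications. Different exponents may
  give the same field element, so \<open>int_span\<close> works with an indexed family.\<close>

lemma algebraic_int_add_mult:
  fixes a b :: "'a::field_char_0"
  assumes "algebraic_int a" "algebraic_int b"
  shows algebraic_int_add: "algebraic_int (a + b)"
    and algebraic_int_mult: "algebraic_int (a * b)"
proof -
  obtain m c where m: "m > 0" "a ^ m = (\<Sum>i<m. of_int (c i) * a ^ i)"
    using algebraic_int_power_reduce[OF assms(1)] by metis
  obtain n d where n: "n > 0" "b ^ n = (\<Sum>i<n. of_int (d i) * b ^ i)"
    using algebraic_int_power_reduce[OF assms(2)] by metis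
  define I where "I = {..<m} \<times> {..<n}"
  define f where "f = (\<lambda>(i, j). a ^ i * b ^ j)"
  have I: "finite I" and O: "(0, 0) \<in> I" "f (0, 0) \<noteq> 0"
    using m n by (auto simp: I_def f_def)
  have A: "a * f k \<in> int_span I f" if kI: "k \<in> I" for k
  proof -
    obtain i j where k: "k = (i, j)" "i < m" "j < n"
      using kI by (auto simp: I_def)
    show ?thesis
    proof (cases "Suc i < m")
      case True
      then have "a * f k = f (Suc i, j)" "(Suc i, j) \<in> I"
        using k by (auto simp: f_def I_def)
      then show ?thesis using int_span_base[OF I] by metis
    next
      case False
      then have "Suc i = m" using k by simp
      have "a * f k = a ^ Suc i * b ^ j"
        using k by (simp add: f_def mult.assoc)
      also have "\<dots> = (\<Sum>i<m. of_int (c i) * f (i, j))"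
        using m(2) \<open>Suc i = m\<close> by (simp add: f_def sum_distrib_right mult.assoc del: power_Suc)
      also have "\<dots> \<in> int_span I f"
        using k by (intro int_span_sum int_span_scale int_span_base[OF I]) (auto simp: I_def)
      finally show ?thesis .
    qed
  qed
  have B: "b * f k \<in> int_span I f" if kI: "k \<in> I" for k
  proof -
    obtain i j where k: "k = (i, j)" "i < m" "j < n"
      using kI by (auto simp: I_def)
    show ?thesis
    proof (cases "Suc j < n")
      case True
      then have "b * f k = f (i, Suc j)" "(i, Suc j) \<in> I"
        using k by (auto simp: f_def I_def)
      then show ?thesis using int_span_base[OF I] by metis
    next
      case False
      then have "Suc j = n" using k by simp
      have "b * f k = a ^ i * b ^ Suc j"
        using k by (simp add: f_def)
      also have "\<dots> = (\<Sum>j<n. of_int (d j) * f (i, j))"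
        using n(2) \<open>Suc j = n\<close> by (simp add: f_def sum_distrib_left algebra_simps del: power_Suc)
      also have "\<dots> \<in> int_span I f"
        using k by (intro int_span_sum int_span_scale int_span_base[OF I]) (auto simp: I_def)
      finally show ?thesis .
    qed
  qed
  have "(a + b) * f k \<in> int_span I f" if "k \<in> I" for k
    using int_span_add[OF A[OF that] B[OF that]] by (simp only: distrib_right)
  then show "algebraic_int (a + b)"
    by (rule algebraic_int_if_stable[where f = f, OF I _ O])
  have "(a * b) * f k \<in> int_span I f" if "k \<in> I" for k
    using int_span_mult[of I a f, OF A B[OF that]] by (simp only: mult.assoc)
  then show "algebraic_int (a * b)"
    by (rule algebraic_int_if_stable[where f = f, OF I _ O])
qed

lemma algebraic_int_diff:
  fixes a b :: "'a::field_char_0"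
  assumes "algebraic_int a" "algebraic_int b"
  shows "algebraic_int (a - b)"
  using algebraic_int_add[of a "- b"] assms by simp

lemma algebraic_int_prod:
  fixes f :: "'i \<Rightarrow> 'a::field_char_0"
  assumes "\<And>i. i \<in> I \<Longrightarrow> algebraic_int (f i)"
  shows "algebraic_int (prod f I)"
  using assms by (induction I rule: infinite_finite_induct) (auto intro: algebraic_int_mult)

section \<open>Primitive elements\<close>

lemma map_poly_mult_hom:
  assumes "comm_ring_hom h"
  shows "map_poly h (p * q) = map_poly h p * map_poly h q"
proof -
  interpret comm_ring_hom h by fact
  show ?thesis
    by (rule poly_eqI) (simp add: coeff_map_poly coeff_mult hom_distribs)
qed

text \<open>The target type is free, so one polynomial can be evaluated in the number field, in its
  algebraic closure and in the complex numbers.\<close>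

definition rat_eval :: "rat poly \<Rightarrow> 'a::field_char_0 \<Rightarrow> 'a" where
  "rat_eval g x = poly (map_poly of_rat g) x"

lemma rat_eval_simps [simp]:
  "rat_eval 0 x = 0" "rat_eval 1 x = 1" "rat_eval [:r:] x = of_rat r"
  "rat_eval [:0, 1:] x = x"
  "rat_eval (f + g) x = rat_eval f x + rat_eval g x"
  "rat_eval (f * g) x = rat_eval f x * rat_eval g x"
  by (simp_all add: rat_eval_def of_rat_hom.map_poly_pCons_hom of_rat_hom.map_poly_hom_add
      map_poly_mult_hom[OF of_rat_hom.comm_ring_hom_axioms])

lemma rat_eval_diff [simp]: "rat_eval (f - g) x = rat_eval f x - rat_eval g x"
  using rat_eval_simps(5)[of "f - g" g x] by simp

text \<open>A nonzero annihilating polynomial of least degree works by division with remainder. It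
  is prime because divisibility by it means vanishing at \<open>x\<close>, and a field has no zero
  divisors.\<close>

lemma rat_minpoly_exists:
  fixes x :: "'a::field_char_0"
  assumes "p \<noteq> 0" "rat_eval p x = 0"
  obtains f where "f \<noteq> 0" "prime_elem f" "\<And>g. rat_eval g x = 0 \<longleftrightarrow> f dvd g"
proof -
  obtain f where f: "f \<noteq> 0" "rat_eval f x = 0"
    and min: "\<And>g. g \<noteq> 0 \<Longrightarrow> rat_eval g x = 0 \<Longrightarrow> degree f \<le> degree g"
    using ex_has_least_nat[of "\<lambda>f. f \<noteq> 0 \<and> rat_eval f x = 0" p degree] assms by blast
  have dvd: "rat_eval g x = 0 \<longleftrightarrow> f dvd g" for g
  proof
    assume "rat_eval g x = 0"
    then have "rat_eval (g mod f) x = 0"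
      using f(2) by (simp flip: minus_div_mult_eq_mod)
    then have "g mod f = 0"
      using min[of "g mod f"] degree_mod_less[OF f(1), of g] by fastforce
    then show "f dvd g" by auto
  next
    assume "f dvd g"
    then show "rat_eval g x = 0" using f(2) by (auto elim!: dvdE)
  qed
  have "\<not> f dvd 1"
    using dvd[of 1] by simp
  moreover have "f dvd a \<or> f dvd b" if "f dvd a * b" for a b
    using that by (simp flip: dvd)
  ultimately have "prime_elem f"
    using f(1) by (auto simp: prime_elem_def)
  with f(1) dvd show ?thesis using that by blast
qed

text \<open>Separability in characteristic 0: the derivative is nonzero of smaller degree, hence
  coprime to the prime \<open>f\<close>, and a Bezout identity excludes a common zero.\<close>

lemma rat_eval_pderiv_nonzero:
  fixes z :: "'a::field_char_0"
  assumes "prime_elem f" "rat_eval f z = 0"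
  shows "rat_eval (pderiv f) z \<noteq> 0"
proof
  assume 0: "rat_eval (pderiv f) z = 0"
  have deg: "degree f \<noteq> 0"
    using assms(1) is_unit_iff_degree prime_elem_not_unit by (metis prime_elem_def)
  have "\<not> f dvd pderiv f"
    using deg dvd_imp_degree_le[of f "pderiv f"] by (auto simp: pderiv_eq_0_iff degree_pderiv)
  then have "coprime f (pderiv f)"
    using assms(1) by (simp add: prime_elem_imp_coprime)
  then obtain u v where "u * f + v * pderiv f = 1"
    by (metis bezout_coefficients_fst_snd coprime_iff_gcd_eq_1)
  then have "rat_eval (u * f + v * pderiv f) z = 1" by simp
  then show False using 0 assms(2) by simp
qed

text \<open>The ring of rational polynomial expressions in \<open>x\<close>. For algebraic
  \<open>x\<close> it is the field generated by \<open>x\<close>.\<close>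

definition rat_adjoin :: "'a::field_char_0 \<Rightarrow> 'a set" where
  "rat_adjoin x = range (\<lambda>g. rat_eval g x)"

lemma rat_adjoin_self: "x \<in> rat_adjoin x"
  unfolding rat_adjoin_def by (rule range_eqI[of _ _ "[:0, 1:]"]) simp

lemma rat_adjoin_of_rat: "of_rat r \<in> rat_adjoin x"
  unfolding rat_adjoin_def by (rule range_eqI[of _ _ "[:r:]"]) simp

lemma rat_adjoin_add: "a \<in> rat_adjoin x \<Longrightarrow> b \<in> rat_adjoin x \<Longrightarrow> a + b \<in> rat_adjoin x"
  unfolding rat_adjoin_def by (auto simp flip: rat_eval_simps(5))

lemma rat_adjoin_mult: "a \<in> rat_adjoin x \<Longrightarrow> b \<in> rat_adjoin x \<Longrightarrow> a * b \<in> rat_adjoin x"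
  unfolding rat_adjoin_def by (auto simp flip: rat_eval_simps(6))

lemma rat_adjoin_0: "0 \<in> rat_adjoin x"
  using rat_adjoin_of_rat[of 0 x] by simp

lemma rat_adjoin_diff: "a \<in> rat_adjoin x \<Longrightarrow> b \<in> rat_adjoin x \<Longrightarrow> a - b \<in> rat_adjoin x"
  unfolding rat_adjoin_def by (auto simp flip: rat_eval_diff)

lemma rat_adjoin_sum: "(\<And>i. i \<in> I \<Longrightarrow> f i \<in> rat_adjoin x) \<Longrightarrow> sum f I \<in> rat_adjoin x"
  by (induction I rule: infinite_finite_induct) (auto intro: rat_adjoin_add rat_adjoin_0)

text \<open>In a Bezout identity between the minimal polynomial of \<open>x\<close> and a polynomial
  representing \<open>y\<close>, the cofactor of the latter represents the inverse.\<close>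

lemma rat_adjoin_inverse:
  fixes x :: "'a::field_char_0"
  assumes "p \<noteq> 0" "rat_eval p x = 0" "y \<in> rat_adjoin x"
  shows "inverse y \<in> rat_adjoin x"
proof (cases "y = 0")
  case True
  then show ?thesis by (simp add: rat_adjoin_0)
next
  case False
  obtain f where f: "prime_elem f" "\<And>g. rat_eval g x = 0 \<longleftrightarrow> f dvd g"
    using rat_minpoly_exists[OF assms(1,2)] by metis
  obtain g where g: "y = rat_eval g x"
    using assms(3) by (auto simp: rat_adjoin_def)
  with False f have "coprime f g"
    by (simp add: prime_elem_imp_coprime)
  then obtain u v where uv: "u * f + v * g = 1"
    by (metis bezout_coefficients_fst_snd coprime_iff_gcd_eq_1)
  have "rat_eval (u * f + v * g) x = 1" by (simp only: uv rat_eval_simps)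
  then have "rat_eval v x * y = 1"
    using f(2)[of f] g by simp
  then have "inverse y = rat_eval v x"
    using False by (simp add: field_simps)
  then show ?thesis by (auto simp: rat_adjoin_def)
qed

section \<open>Polynomials over a subfield and their roots in an algebraic closure\<close>

lemma to_ac_of_rat: "to_ac (of_rat r :: 'a::field_char_0) = of_rat r"
  by (cases r) (simp add: of_rat_rat)

lemma field_hom_to_ac: "field_hom (to_ac :: 'a::field_char_0 \<Rightarrow> 'a alg_closure)"
  by unfold_locales simp_all

lemma map_poly_to_ac_of_rat: "map_poly to_ac (map_poly of_rat f :: 'a::field_char_0 poly) = map_poly of_rat f"
  by (simp add: map_poly_map_poly o_def to_ac_of_rat)

text \<open>A subfield depending on an element is not a type, so polynomials over it are polynomials
  over the large field subject to this predicate.\<close>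

definition coeffs_in :: "'a::zero set \<Rightarrow> 'a poly \<Rightarrow> bool" where
  "coeffs_in F p \<longleftrightarrow> (\<forall>i. coeff p i \<in> F)"

lemma coeffs_in_add: "coeffs_in (rat_adjoin x) p \<Longrightarrow> coeffs_in (rat_adjoin x) q \<Longrightarrow> coeffs_in (rat_adjoin x) (p + q)"
  by (simp add: coeffs_in_def rat_adjoin_add)

lemma coeffs_in_diff: "coeffs_in (rat_adjoin x) p \<Longrightarrow> coeffs_in (rat_adjoin x) q \<Longrightarrow> coeffs_in (rat_adjoin x) (p - q)"
  by (simp add: coeffs_in_def rat_adjoin_diff)

lemma coeffs_in_mult: "coeffs_in (rat_adjoin x) p \<Longrightarrow> coeffs_in (rat_adjoin x) q \<Longrightarrow> coeffs_in (rat_adjoin x) (p * q)"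
  by (simp add: coeffs_in_def coeff_mult rat_adjoin_sum rat_adjoin_mult)

lemma coeffs_in_pCons: "a \<in> F \<Longrightarrow> coeffs_in F p \<Longrightarrow> coeffs_in F (pCons a p)"
  by (simp add: coeffs_in_def coeff_pCons split: nat.splits)

lemma coeffs_in_const: "a \<in> rat_adjoin x \<Longrightarrow> coeffs_in (rat_adjoin x) [:a:]"
  by (intro coeffs_in_pCons) (simp_all add: coeffs_in_def rat_adjoin_0)

lemma coeffs_in_pcompose_of_rat:
  assumes "coeffs_in (rat_adjoin x) q"
  shows "coeffs_in (rat_adjoin x) (pcompose (map_poly of_rat f) q)"
proof (induction f)
  case 0
  then show ?case by (simp add: coeffs_in_def rat_adjoin_0)
next
  case (pCons a f)
  then show ?case
    using assms by (simp add: of_rat_hom.map_poly_pCons_hom pcompose_pCons coeffs_in_add coeffs_in_mult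
        coeffs_in_const rat_adjoin_of_rat)
qed

text \<open>Division by \<open>h\<close> is done by cancelling leading terms, so that all
  coefficients visibly stay in the subfield; the inverse of the leading coefficient lies there
  because \<open>x\<close> is algebraic.\<close>

lemma minpoly_over_rat_adjoin:
  fixes x y :: "'a::field_char_0"
  assumes x: "\<exists>p. p \<noteq> 0 \<and> rat_eval p x = 0"
    and y: "q \<noteq> 0" "coeffs_in (rat_adjoin x) q" "poly q y = 0"
  obtains h where "h \<noteq> 0" "coeffs_in (rat_adjoin x) h" "poly h y = 0"
    "\<And>p. coeffs_in (rat_adjoin x) p \<Longrightarrow> poly p y = 0 \<Longrightarrow> h dvd p"
proof -
  obtain h where h: "h \<noteq> 0" "coeffs_in (rat_adjoin x) h" "poly h y = 0"
    and min: "\<And>p. p \<noteq> 0 \<Longrightarrow> coeffs_in (rat_adjoin x) p \<Longrightarrow> poly p y = 0 \<Longrightarrow> degree h \<le> degree p"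
    using ex_has_least_nat[of "\<lambda>p. p \<noteq> 0 \<and> coeffs_in (rat_adjoin x) p \<and> poly p y = 0" q degree] y
    by blast
  have inv: "inverse a \<in> rat_adjoin x" if "a \<in> rat_adjoin x" for a
    using x rat_adjoin_inverse that by blast
  have "h dvd p" if "coeffs_in (rat_adjoin x) p" "poly p y = 0" for p
    using that
  proof (induction "degree p" arbitrary: p rule: less_induct)
    case less
    show ?case
    proof (cases "p = 0")
      case False
      then have deg: "degree h \<le> degree p" using min less by blast
      define c where "c = coeff p (degree p) * inverse (coeff h (degree h))"
      define m where "m = monom c (degree p - degree h)"
      have c: "c \<in> rat_adjoin x"
        using less(2) h(2) inv by (auto simp: c_def coeffs_in_def intro!: rat_adjoin_mult)
      have m: "coeffs_in (rat_adjoin x) m"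
        using c by (auto simp: coeffs_in_def m_def coeff_monom rat_adjoin_0)
      have hp: "coeffs_in (rat_adjoin x) (p - m * h)" "poly (p - m * h) y = 0"
        using less m h by (auto intro: coeffs_in_diff coeffs_in_mult)
      have "c \<noteq> 0" using False h(1) by (simp add: c_def)
      then have degm: "degree (m * h) = degree p"
      proof -
        have "degree m = degree p - degree h" "m \<noteq> 0"
          unfolding m_def using \<open>c \<noteq> 0\<close> by (simp_all add: Polynomial.degree_monom_eq monom_eq_0_iff)
        then show ?thesis
          using deg h(1) by (simp add: Polynomial.degree_mult_eq)
      qed
      moreover have "coeff (m * h) (degree p) = coeff p (degree p)"
      proof -
        have "coeff (m * h) (degree p) = lead_coeff (m * h)" by (simp add: degm)
        also have "\<dots> = c * lead_coeff h" by (simp only: lead_coeff_mult m_def lead_coeff_monom)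
        finally show ?thesis using h(1) by (simp add: c_def)
      qed
      ultimately have "p - m * h = 0 \<or> degree (p - m * h) < degree p"
        using degree_diff_le[of p "degree p" "m * h"] eq_zero_or_degree_less[of "p - m * h" "degree p"]
        by auto
      then have "h dvd p - m * h"
        using less(1)[OF _ hp] by auto
      then have "h dvd (p - m * h) + m * h"
        by (intro dvd_add) auto
      then show ?thesis by simp
    qed simp
  qed
  with h show ?thesis using that by blast
qed

lemma finite_roots_rat: "f \<noteq> 0 \<Longrightarrow> finite {z::'a::field_char_0. rat_eval f z = 0}"
  unfolding rat_eval_def by (intro poly_roots_finite) (simp add: map_poly_eq_0_iff)

text \<open>The generator is \<open>c = a + t * b\<close> for a rational \<open>t\<close> avoiding
  finitely many values. The minimal polynomial \<open>h\<close> of \<open>b\<close> over the field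
  of \<open>c\<close> divides two polynomials whose only common root is \<open>b\<close>, and
  separability makes it linear.\<close>

lemma primitive_element_two:
  fixes a b :: "'a::field_char_0"
  assumes alg: "\<And>x::'a. \<exists>p. p \<noteq> 0 \<and> rat_eval p x = 0"
  obtains c where "a \<in> rat_adjoin c" "b \<in> rat_adjoin c"
proof -
  interpret ac: field_hom "to_ac :: 'a \<Rightarrow> 'a alg_closure"
    by (rule field_hom_to_ac)
  obtain f where f: "f \<noteq> 0" "rat_eval f a = 0"
    using alg by blast
  obtain g where g: "g \<noteq> 0" "prime_elem g" "rat_eval g b = 0"
  proof -
    obtain p where "p \<noteq> 0" "rat_eval p b = 0"
      using alg[of b] by blast
    then obtain g where "g \<noteq> 0" "prime_elem g" "\<And>p. rat_eval p b = 0 \<longleftrightarrow> g dvd p"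
      using rat_minpoly_exists[of p b] by blast
    then show thesis using that[of g] by simp
  qed
  define R where "R = {z :: 'a alg_closure. rat_eval f z = 0}"
  define S where "S = {z :: 'a alg_closure. rat_eval g z = 0} - {to_ac b}"
  \<comment> \<open>The forbidden values of \<open>t\<close>: those with
    \<open>z + t * w = a + t * b\<close> for a root \<open>z\<close> of \<open>f\<close> and a root
    \<open>w\<close> of \<open>g\<close> other than \<open>b\<close>.\<close>
  define B where "B = (\<lambda>(z, w). (z - to_ac a) / (to_ac b - w)) ` (R \<times> S)"
  have "finite B"
    using finite_roots_rat[OF f(1)] finite_roots_rat[OF g(1)] unfolding B_def R_def S_def
    by (intro finite_imageI finite_SigmaI finite_Diff)
  then have "finite (of_rat -` B)"
    by (intro finite_vimageI) (auto simp: inj_def)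
  then obtain t :: rat where "t \<notin> of_rat -` B"
    using ex_new_if_finite[OF infinite_UNIV_char_0] by blast
  then have t: "of_rat t \<notin> B" by simp
  define c where "c = a + of_rat t * b"
  \<comment> \<open>Composing \<open>f\<close> with \<open>q\<close> gives a polynomial over the
    field of \<open>c\<close> that vanishes at \<open>b\<close>, because
    \<open>c - t * b = a\<close>.\<close>
  define q where "q = [:c, - of_rat t:]"
  have q: "coeffs_in (rat_adjoin c) q"
    unfolding q_def using rat_adjoin_of_rat[of "- t" c]
    by (intro coeffs_in_pCons coeffs_in_const rat_adjoin_self) (simp add: of_rat_minus)
  have of_rat_in: "coeffs_in (rat_adjoin c) (map_poly of_rat g)"
    by (simp add: coeffs_in_def coeff_map_poly rat_adjoin_of_rat)
  obtain h where h: "h \<noteq> 0" "coeffs_in (rat_adjoin c) h" "poly h b = 0"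
    and dvd: "\<And>p. coeffs_in (rat_adjoin c) p \<Longrightarrow> poly p b = 0 \<Longrightarrow> h dvd p"
  proof -
    have "map_poly of_rat g \<noteq> (0 :: 'a poly)" "poly (map_poly of_rat g) b = 0"
      using g by (simp_all add: map_poly_eq_0_iff rat_eval_def)
    from minpoly_over_rat_adjoin[OF alg[of c] this(1) of_rat_in this(2)] that
    show thesis by blast
  qed
  have dvd_g: "h dvd map_poly of_rat g"
    using dvd[OF of_rat_in] g by (simp add: rat_eval_def)
  have dvd_f: "h dvd pcompose (map_poly of_rat f) q"
    using f(2) by (intro dvd coeffs_in_pcompose_of_rat q) (simp add: poly_pcompose q_def c_def rat_eval_def)
  \<comment> \<open>Another root \<open>z\<close> of \<open>h\<close> is a root of \<open>g\<close>,
    and \<open>c - t * z\<close> is a root of \<open>f\<close>, which puts \<open>t\<close> into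
    \<open>B\<close>.\<close>
  have only_root: "z = to_ac b" if z: "poly (map_poly to_ac h) z = 0" for z
  proof (rule ccontr)
    assume "z \<noteq> to_ac b"
    have root: "poly (map_poly to_ac p) z = 0" if "h dvd p" for p
    proof -
      from \<open>h dvd p\<close> obtain k where "p = h * k" by (rule dvdE)
      then show ?thesis using z by (simp add: map_poly_mult_hom[OF ac.comm_ring_hom_axioms])
    qed
    have "rat_eval g z = 0"
      using root[OF dvd_g] by (simp add: map_poly_to_ac_of_rat rat_eval_def)
    then have "z \<in> S" using \<open>z \<noteq> to_ac b\<close> by (simp add: S_def)
    moreover have "to_ac c - of_rat t * z \<in> R"
      using root[OF dvd_f]
      by (simp add: ac.map_poly_pcompose poly_pcompose map_poly_to_ac_of_rat R_def rat_eval_def q_def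
          ac.map_poly_pCons_hom to_ac_of_rat mult.commute[of z])
    moreover have "of_rat t = (to_ac c - of_rat t * z - to_ac a) / (to_ac b - z)"
      using \<open>z \<noteq> to_ac b\<close> by (simp add: c_def to_ac_of_rat field_simps)
    ultimately have "of_rat t \<in> B"
      unfolding B_def by (intro image_eqI[of _ _ "(to_ac c - of_rat t * z, z)"]) auto
    then show False using t by simp
  qed
  obtain k where k: "h = [:- b, 1:] * k"
    using h(3) by (auto simp: poly_eq_0_iff_dvd)
  \<comment> \<open>A root of \<open>k\<close> could only be \<open>b\<close> again, making
    \<open>b\<close> a double root of \<open>g\<close> against separability.\<close>
  have "degree k = 0"
  proof (rule ccontr)
    assume "degree k \<noteq> 0"
    then obtain z where z: "poly (map_poly to_ac k) z = 0"
      using alg_closed_imp_poly_has_root[of "map_poly to_ac k"] by auto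
    then have "z = to_ac b"
      by (intro only_root) (simp add: k map_poly_mult_hom[OF ac.comm_ring_hom_axioms] del: mult_pCons_left)
    with z have "poly k b = 0" by simp
    then have "[:- b, 1:] * [:- b, 1:] dvd h"
      unfolding k by (intro mult_dvd_mono) (simp_all add: poly_eq_0_iff_dvd)
    then have "[:- b, 1:] * [:- b, 1:] dvd map_poly of_rat g"
      using dvd_g by (rule dvd_trans)
    then obtain m where "map_poly of_rat g = ([:- b, 1:] * [:- b, 1:]) * m"
      by (rule dvdE)
    then have m: "map_poly of_rat g = [:- b, 1:] * ([:- b, 1:] * m)"
      by (simp only: mult.assoc)
    have "poly (pderiv (map_poly of_rat g)) b = 0"
      unfolding m by (simp add: pderiv_mult del: mult_pCons_left)
    then show False
      using rat_eval_pderiv_nonzero[OF g(2,3)] by (simp add: rat_eval_def of_rat_hom.map_poly_pderiv)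
  qed
  then obtain e where "k = [:e:]" by (auto elim: degree_eq_zeroE)
  then have e: "h = [:- b * e, e:]" "e \<noteq> 0" using k h(1) by auto
  \<comment> \<open>\<open>h\<close> is linear over the field of \<open>c\<close>, so its root
    \<open>b\<close> belongs to that field.\<close>
  then have "- b * e \<in> rat_adjoin c" "e \<in> rat_adjoin c"
    using h(2) by (auto simp: coeffs_in_def coeff_pCons dest: spec[of _ 0] spec[of _ 1])
  then have "0 - (- b * e) * inverse e \<in> rat_adjoin c"
    using rat_adjoin_inverse[of _ c e] alg[of c] by (blast intro: rat_adjoin_mult rat_adjoin_diff rat_adjoin_0)
  then have b: "b \<in> rat_adjoin c" using e(2) by (simp add: mult.assoc)
  then have "c - of_rat t * b \<in> rat_adjoin c"
    by (intro rat_adjoin_diff rat_adjoin_mult rat_adjoin_of_rat rat_adjoin_self)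
  with b show ?thesis using that by (simp add: c_def)
qed

section \<open>Complex embeddings and the norm\<close>

lemma rat_vector_space: "vector_space (\<lambda>(q::rat) (x::'k::field_char_0). of_rat q * x)"
  by unfold_locales (simp_all add: algebra_simps of_rat_add of_rat_mult)

lemma rat_eval_eq_sum:
  assumes "degree g < n"
  shows "rat_eval g x = (\<Sum>i<n. of_rat (coeff g i) * x ^ i)"
proof -
  have "rat_eval g x = (\<Sum>i\<le>degree g. of_rat (coeff g i) * x ^ i)"
    by (simp add: rat_eval_def poly_altdef)
  also have "\<dots> = (\<Sum>i<n. of_rat (coeff g i) * x ^ i)"
    using assms by (intro sum.mono_neutral_left) (auto simp: coeff_eq_0)
  finally show ?thesis .
qed

lemma coeff_sum_monom: "coeff (\<Sum>i<n. monom (c i) i) k = (if k < n then c k else 0)"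
  by (simp add: coeff_sum)

lemma degree_sum_monom: "n > 0 \<Longrightarrow> degree (\<Sum>i<n. monom (c i) i) < n"
  by (rule degree_lessI) (auto simp: coeff_sum_monom)

text \<open>For an indexed family, independence includes injectivity, since a repeated value gives a
  relation with coefficients 1 and -1. The image therefore has \<open>n\<close> elements.\<close>

lemma number_field_independent_le:
  fixes f :: "nat \<Rightarrow> 'k::field_char_0"
  assumes K: "number_field TYPE('k)"
    and indep: "\<And>c::nat \<Rightarrow> rat. (\<Sum>i<n. of_rat (c i) * f i) = 0 \<Longrightarrow> \<forall>i<n. c i = 0"
  shows "n \<le> number_field_degree TYPE('k)"
proof -
  interpret V: vector_space "\<lambda>(q::rat) (x::'k). of_rat q * x"
    by (rule rat_vector_space)
  have inj: "inj_on f {..<n}"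
  proof (rule inj_onI, rule ccontr)
    fix i j assume ij: "i \<in> {..<n}" "j \<in> {..<n}" "f i = f j" "i \<noteq> j"
    define c :: "nat \<Rightarrow> rat" where "c k = (if k = i then 1 else 0) - (if k = j then 1 else 0)" for k
    have "of_rat (c k) * f k = (if k = i then f i else 0) - (if k = j then f j else 0)" for k
      by (simp add: c_def of_rat_diff)
    then have "(\<Sum>k<n. of_rat (c k) * f k) = 0"
      using ij by (simp add: sum_subtractf)
    then have "c i = 0" using indep ij by auto
    then show False using ij by (simp add: c_def)
  qed
  define S where "S = f ` {..<n}"
  have "V.independent S"
  proof
    assume "V.dependent S"
    moreover have "finite S" by (simp add: S_def)
    ultimately obtain u v where uv: "v \<in> S" "u v \<noteq> 0" "(\<Sum>v\<in>S. of_rat (u v) * v) = 0"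
      using V.dependent_finite by blast
    have "(\<Sum>i<n. of_rat ((u \<circ> f) i) * f i) = 0"
      using uv(3) by (simp add: S_def sum.reindex[OF inj])
    then have "\<forall>i<n. (u \<circ> f) i = 0" by (rule indep)
    moreover obtain i where "i < n" "v = f i"
      using uv(1) by (auto simp: S_def)
    ultimately show False using uv(2) by simp
  qed
  obtain B where B: "finite B" "V.span B = UNIV"
    using K unfolding number_field_def by blast
  obtain b where b: "b \<subseteq> UNIV" "V.independent b" "UNIV \<subseteq> V.span b" "card b = V.dim UNIV"
    by (rule V.basis_exists)
  \<comment> \<open>The exchange bound below needs a finite set; the finite spanning set of the
    number field supplies finiteness of the basis behind the dimension.\<close>
  have "finite b"
    using V.independent_span_bound[OF B(1) b(2)] B(2) by blast
  then have "card S \<le> card b"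
    using V.independent_span_bound[OF _ \<open>V.independent S\<close>] b(3) by blast
  then show ?thesis
    by (simp add: S_def card_image[OF inj] b(4) number_field_degree_def)
qed

lemma number_field_algebraic:
  fixes x :: "'k::field_char_0"
  assumes K: "number_field TYPE('k)"
  shows "\<exists>p. p \<noteq> 0 \<and> rat_eval p x = 0"
proof -
  define n where "n = Suc (number_field_degree TYPE('k))"
  have "\<not> (\<forall>c::nat \<Rightarrow> rat. (\<Sum>i<n. of_rat (c i) * x ^ i) = 0 \<longrightarrow> (\<forall>i<n. c i = 0))"
  proof
    assume *: "\<forall>c::nat \<Rightarrow> rat. (\<Sum>i<n. of_rat (c i) * x ^ i) = 0 \<longrightarrow> (\<forall>i<n. c i = 0)"
    have "n \<le> number_field_degree TYPE('k)"
      by (rule number_field_independent_le[OF K, of "\<lambda>i. x ^ i" n]) (use * in blast)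
    then show False by (simp add: n_def)
  qed
  then obtain c :: "nat \<Rightarrow> rat" and i where c: "(\<Sum>i<n. of_rat (c i) * x ^ i) = 0" "i < n" "c i \<noteq> 0"
    by blast
  define p where "p = (\<Sum>i<n. monom (c i) i)"
  have "coeff p i \<noteq> 0"
    using c(2,3) by (simp add: p_def coeff_sum_monom)
  then have "p \<noteq> 0" by auto
  moreover have "rat_eval p x = 0"
    using degree_sum_monom[of n c] c
    by (subst rat_eval_eq_sum[of _ n]) (auto simp: p_def coeff_sum_monom)
  ultimately show ?thesis by blast
qed

lemma rat_adjoin_mono:
  assumes "a \<in> rat_adjoin c"
  shows "rat_adjoin a \<subseteq> rat_adjoin c"
proof
  have pow: "a ^ i \<in> rat_adjoin c" for i
    using assms rat_adjoin_of_rat[of 1 c] by (induction i) (auto intro: rat_adjoin_mult)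
  fix y assume "y \<in> rat_adjoin a"
  then obtain g where "y = rat_eval g a" by (auto simp: rat_adjoin_def)
  then show "y \<in> rat_adjoin c"
    using rat_eval_eq_sum[of g "Suc (degree g)" a]
    by (auto intro!: rat_adjoin_sum rat_adjoin_mult rat_adjoin_of_rat pow simp del: sum.lessThan_Suc)
qed

text \<open>A finite spanning set is absorbed element by element; the resulting field is a rational
  subspace containing it.\<close>

theorem primitive_element:
  assumes K: "number_field TYPE('k::field_char_0)"
  obtains \<theta> :: "'k::field_char_0" where "rat_adjoin \<theta> = UNIV"
proof -
  interpret V: vector_space "\<lambda>(q::rat) (x::'k). of_rat q * x"
    by (rule rat_vector_space)
  obtain B :: "'k set" where B: "finite B" "V.span B = UNIV"
    using K unfolding number_field_def by blast
  from B(1) have "\<exists>c. B \<subseteq> rat_adjoin c"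
  proof (induction B rule: finite_induct)
    case (insert x B)
    then obtain c where c: "B \<subseteq> rat_adjoin c" by blast
    obtain e where "c \<in> rat_adjoin e" "x \<in> rat_adjoin e"
      using primitive_element_two[OF number_field_algebraic[OF K]] by blast
    then show ?case using c rat_adjoin_mono[of c e] by blast
  qed simp
  then obtain c where c: "B \<subseteq> rat_adjoin c" by blast
  have "V.subspace (rat_adjoin c)"
    by (intro V.subspaceI rat_adjoin_0 rat_adjoin_add rat_adjoin_mult rat_adjoin_of_rat)
  then have "rat_adjoin c = UNIV"
    using V.span_minimal[OF c] B(2) by blast
  then show ?thesis using that by blast
qed

section \<open>Embeddings as conjugates of a generator, and the norm of an algebraic integer\<close>

lemma field_hom_complex_embedding:
  assumes "\<sigma> \<in> complex_embeddings"
  shows "field_hom \<sigma>"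
proof -
  have hom: "\<sigma> 1 = 1" "\<sigma> (x + y) = \<sigma> x + \<sigma> y" "\<sigma> (x * y) = \<sigma> x * \<sigma> y" for x y
    using assms by (auto simp: complex_embeddings_def)
  have "\<sigma> 0 = 0"
    using hom(2)[of 0 0] by simp
  with hom show ?thesis by unfold_locales simp_all
qed

lemma complex_embedding_of_int:
  assumes "\<sigma> \<in> complex_embeddings"
  shows "\<sigma> (of_int k) = of_int k"
proof -
  interpret field_hom \<sigma> by (rule field_hom_complex_embedding[OF assms])
  have nat: "\<sigma> (of_nat n) = of_nat n" for n
    by (induction n) (simp_all add: hom_add)
  show ?thesis
    by (cases k) (simp_all add: nat hom_uminus del: of_nat_Suc)
qed

lemma complex_embedding_of_rat:
  assumes "\<sigma> \<in> complex_embeddings"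
  shows "\<sigma> (of_rat r) = of_rat r"
proof -
  interpret field_hom \<sigma> by (rule field_hom_complex_embedding[OF assms])
  obtain a b where r: "r = Rat.Fract a b" "b > 0" by (cases r) auto
  have "\<sigma> (of_rat r) * of_int b = \<sigma> (of_rat r * of_int b)"
    by (simp add: hom_distribs complex_embedding_of_int[OF assms])
  also have "of_rat r * of_int b = of_int a"
    using r by (simp add: of_rat_rat)
  also have "\<sigma> (of_int a) = of_rat r * of_int b"
    using r by (simp add: of_rat_rat complex_embedding_of_int[OF assms])
  finally show ?thesis using r(2) by simp
qed

lemma complex_embedding_rat_eval:
  assumes "\<sigma> \<in> complex_embeddings"
  shows "\<sigma> (rat_eval g x) = rat_eval g (\<sigma> x)"
proof -
  interpret field_hom \<sigma> by (rule field_hom_complex_embedding[OF assms])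
  show ?thesis
    unfolding rat_eval_eq_sum[of g "Suc (degree g)", OF lessI]
    by (simp add: hom_distribs complex_embedding_of_rat[OF assms] del: sum.lessThan_Suc)
qed

lemma complex_embedding_algebraic_int:
  assumes "\<sigma> \<in> complex_embeddings" "algebraic_int x"
  shows "algebraic_int (\<sigma> x)"
proof -
  from iffD1[OF algebraic_int_altdef_ipoly assms(2)]
  obtain p where p: "poly (map_poly of_int p) x = 0" "lead_coeff p = 1"
    by (elim exE conjE)
  interpret field_hom \<sigma> by (rule field_hom_complex_embedding[OF assms(1)])
  have "map_poly \<sigma> (map_poly of_int p) = map_poly of_int p"
    by (rule poly_eqI) (simp add: coeff_map_poly complex_embedding_of_int[OF assms(1)])
  then have "poly (map_poly of_int p) (\<sigma> x) = \<sigma> (poly (map_poly of_int p) x)"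
    using poly_map_poly[of "map_poly of_int p" x] by argo
  also have "\<dots> = 0"
    unfolding p(1) by (rule hom_zero)
  finally show ?thesis
    unfolding algebraic_int_altdef_ipoly using p(2) by (intro exI[of _ p] conjI)
qed

text \<open>An embedding is determined by the image of the generator. Conversely, evaluation at any
  root of \<open>f\<close> respects all relations of the generator, as these are the multiples of
  \<open>f\<close>.\<close>

lemma bij_betw_embeddings_roots:
  fixes \<theta> :: "'k::field_char_0"
  assumes gen: "rat_adjoin \<theta> = UNIV"
    and f: "\<And>g. rat_eval g \<theta> = 0 \<longleftrightarrow> f dvd g"
  shows "bij_betw (\<lambda>\<sigma>. \<sigma> \<theta>) (complex_embeddings :: ('k \<Rightarrow> complex) set) {z. rat_eval f z = 0}"
proof (rule bij_betwI')
  have ex: "\<exists>g. x = rat_eval g \<theta>" for x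
    using gen by (auto simp: rat_adjoin_def)
  fix \<sigma> :: "'k \<Rightarrow> complex" assume \<sigma>: "\<sigma> \<in> complex_embeddings"
  interpret field_hom \<sigma> by (rule field_hom_complex_embedding[OF \<sigma>])
  show "\<sigma> \<theta> \<in> {z. rat_eval f z = 0}"
    using complex_embedding_rat_eval[OF \<sigma>, of f \<theta>] f[of f] by simp
  fix \<tau> :: "'k \<Rightarrow> complex" assume \<tau>: "\<tau> \<in> complex_embeddings"
  show "\<sigma> \<theta> = \<tau> \<theta> \<longleftrightarrow> \<sigma> = \<tau>"
  proof
    assume eq: "\<sigma> \<theta> = \<tau> \<theta>"
    show "\<sigma> = \<tau>"
    proof
      fix x
      obtain g where "x = rat_eval g \<theta>" using ex by blast
      then show "\<sigma> x = \<tau> x"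
        using complex_embedding_rat_eval[OF \<sigma>, of g \<theta>] complex_embedding_rat_eval[OF \<tau>, of g \<theta>] eq
        by simp
    qed
  qed simp
next
  fix z :: complex assume "z \<in> {z. rat_eval f z = 0}"
  then have z: "rat_eval f z = 0" by simp
  have ex: "\<exists>g. x = rat_eval g \<theta>" for x
    using gen by (auto simp: rat_adjoin_def)
  then obtain G where G: "\<And>x. x = rat_eval (G x) \<theta>"
    by metis
  define \<sigma> where "\<sigma> x = rat_eval (G x) z" for x
  \<comment> \<open>Independence of the chosen representatives \<open>G\<close>: two of them differ
    by a multiple of \<open>f\<close>, which vanishes at \<open>z\<close>.\<close>
  have \<sigma>: "\<sigma> x = rat_eval g z" if "x = rat_eval g \<theta>" for x g
  proof -
    have "rat_eval (G x - g) \<theta> = 0"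
      using that G[of x] by simp
    then have "f dvd G x - g" by (simp only: f)
    then obtain k where "G x - g = f * k" by (rule dvdE)
    then have "rat_eval (G x - g) z = 0"
      using z by simp
    then show ?thesis by (simp add: \<sigma>_def)
  qed
  have "\<sigma> 1 = 1"
    using \<sigma>[of 1 1] by simp
  moreover have "\<sigma> (x + y) = \<sigma> x + \<sigma> y" for x y
    using \<sigma>[of "x + y" "G x + G y"] G[of x] G[of y] by (simp add: \<sigma>_def)
  moreover have "\<sigma> (x * y) = \<sigma> x * \<sigma> y" for x y
    using \<sigma>[of "x * y" "G x * G y"] G[of x] G[of y] by (simp add: \<sigma>_def)
  ultimately have "\<sigma> \<in> complex_embeddings"
    by (simp add: complex_embeddings_def)
  moreover have "z = \<sigma> \<theta>"
    using \<sigma>[of \<theta> "[:0, 1:]"] by simp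
  ultimately show "\<exists>\<sigma>\<in>complex_embeddings. z = \<sigma> \<theta>" by blast
qed

lemma card_complex_roots:
  assumes "prime_elem f"
  shows "card {z::complex. rat_eval f z = 0} = degree f"
proof -
  let ?p = "map_poly of_rat f :: complex poly"
  have "?p \<noteq> 0"
    using assms by (auto simp: prime_elem_def map_poly_eq_0_iff)
  moreover have "rsquarefree ?p"
    unfolding rsquarefree_roots using rat_eval_pderiv_nonzero[OF assms]
    by (auto simp: rat_eval_def of_rat_hom.map_poly_pderiv)
  ultimately show ?thesis
    using rsquarefree_card_degree by (simp add: rat_eval_def)
qed

text \<open>Multiplication by the value of \<open>h\<close> at a generator has a rational matrix in the basis of powers of the generator, and the
  Vandermonde matrix of the conjugates of the generator diagonalises it.\<close>

lemma prod_conjugates_rational: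
  fixes z :: "nat \<Rightarrow> complex"
  assumes f: "prime_elem f" and z: "bij_betw z {..<degree f} {z. rat_eval f z = 0}"
  shows "(\<Prod>i<degree f. rat_eval h (z i)) \<in> \<rat>"
proof -
  define n where "n = degree f"
  have f0: "f \<noteq> 0" using f by auto
  have n: "n > 0"
    using f is_unit_iff_degree[OF f0] by (auto simp: n_def prime_elem_def)
  have root: "rat_eval f (z i) = 0" if "i < n" for i
    using z that by (auto simp: bij_betw_def n_def)
  \<comment> \<open>The coefficients of \<open>g j\<close> are column \<open>j\<close> of the matrix
    of multiplication by \<open>h\<close> modulo \<open>f\<close>.\<close>
  define g where "g j = (h * monom 1 j) mod f" for j
  have deg_g: "degree (g j) < n" for j
    using degree_mod_less[OF f0, of "h * monom 1 j"] n by (auto simp: g_def n_def)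
  have eval_g: "rat_eval (g j) (z i) = rat_eval h (z i) * z i ^ j" if "i < n" for i j
  proof -
    have "rat_eval (monom 1 j) (z i) = z i ^ j"
      by (simp add: rat_eval_def map_poly_monom poly_monom)
    then show ?thesis
      unfolding g_def using root[OF that] by (simp flip: minus_div_mult_eq_mod)
  qed
  define W where "W = Matrix.mat n n (\<lambda>(i, k). z i ^ k)"
  define N where "N = Matrix.mat n n (\<lambda>(k, j). coeff (g j) k)"
  define D where "D = Matrix.mat n n (\<lambda>(i, k). if i = k then rat_eval h (z i) else 0)"
  have W: "W \<in> carrier_mat n n" and N: "map_mat of_rat N \<in> carrier_mat n n" and D: "D \<in> carrier_mat n n"
    by (auto simp: W_def N_def D_def)
  have "W * map_mat of_rat N = D * W"
  proof (rule eq_matI)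
    fix i j assume "i < dim_row (D * W)" "j < dim_col (D * W)"
    then have ij: "i < n" "j < n" by (simp_all add: W_def D_def)
    have "index_mat (W * map_mat of_rat N) (i, j) = (\<Sum>k<n. of_rat (coeff (g j) k) * z i ^ k)"
      using ij by (simp add: W_def N_def scalar_prod_def atLeast0LessThan mult.commute)
    also have "\<dots> = rat_eval h (z i) * z i ^ j"
      using rat_eval_eq_sum[OF deg_g] eval_g[OF ij(1)] by metis
    also have "\<dots> = (\<Sum>k<n. if k = i then rat_eval h (z i) * z k ^ j else 0)"
      using ij by simp
    also have "\<dots> = (\<Sum>k<n. (if i = k then rat_eval h (z i) else 0) * z k ^ j)"
      by (intro sum.cong) auto
    also have "\<dots> = index_mat (D * W) (i, j)"
      using ij by (simp add: W_def D_def scalar_prod_def atLeast0LessThan)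
    finally show "index_mat (W * map_mat of_rat N) (i, j) = index_mat (D * W) (i, j)" .
  qed (auto simp: W_def N_def D_def)
  then have "Determinant.det W * Determinant.det (map_mat of_rat N) = Determinant.det D * Determinant.det W"
    by (simp only: det_mult[OF W N, symmetric] det_mult[OF D W, symmetric])
  moreover have "Determinant.det W \<noteq> 0"
  proof
    assume "Determinant.det W = 0"
    then obtain v where v: "v \<in> carrier_vec n" "v \<noteq> 0\<^sub>v n" "W *\<^sub>v v = 0\<^sub>v n"
      using det_0_iff_vec_prod_zero[OF W] by blast
    \<comment> \<open>A kernel vector of \<open>W\<close> is the coefficient list of a polynomial of
      degree below \<open>n\<close> vanishing at all \<open>n\<close> conjugates.\<close>
    define p where "p = (\<Sum>k<n. monom (vec_index v k) k)"
    have "poly p (z i) = 0" if "i < n" for i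
    proof -
      have "poly p (z i) = vec_index (W *\<^sub>v v) i"
        using that v(1) by (simp add: p_def W_def scalar_prod_def atLeast0LessThan poly_sum poly_monom mult.commute)
      then show ?thesis using v(3) that by simp
    qed
    then have "z ` {..<n} \<subseteq> {x. poly p x = 0}" by auto
    then have sub: "{z. rat_eval f z = 0} \<subseteq> {x. poly p x = 0}"
      using z by (simp add: bij_betw_def n_def)
    have "p = 0"
    proof (rule ccontr)
      assume "p \<noteq> 0"
      then have "card {z::complex. rat_eval f z = 0} \<le> degree p"
        using card_mono[OF poly_roots_finite sub] card_poly_roots_bound[of p] by linarith
      then show False
        using degree_sum_monom[OF n, of "vec_index v"] card_complex_roots[OF f] by (simp add: p_def n_def)
    qed
    then have "vec_index v k = 0" if "k < n" for k
      using coeff_sum_monom[of "vec_index v" n k] that by (simp add: p_def)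
    then show False using v(1,2) by (auto intro!: eq_vecI)
  qed
  ultimately have "Determinant.det D = of_rat (Determinant.det N)"
    by (simp add: of_rat_hom.hom_det)
  moreover have "Determinant.det D = (\<Prod>i<n. rat_eval h (z i))"
  proof -
    have "upper_triangular D" by (auto simp: D_def)
    then have "Determinant.det D = prod_list (diag_mat D)"
      by (rule det_upper_triangular[OF _ D])
    also have "diag_mat D = map (\<lambda>i. rat_eval h (z i)) [0..<n]"
      by (auto simp: diag_mat_def D_def)
    also have "prod_list \<dots> = (\<Prod>i<n. rat_eval h (z i))"
      by (simp add: prod.distinct_set_conv_list[symmetric] atLeast0LessThan)
    finally show ?thesis .
  qed
  ultimately show ?thesis by (simp add: n_def)
qed

text \<open>The product of the conjugates of \<open>a\<close> is rational by
  \<open>prod_conjugates_rational\<close> and an algebraic integer, hence an integer; it is nonzero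
  because embeddings are injective.\<close>

theorem complex_embeddings_norm:
  assumes K: "number_field TYPE('k::field_char_0)"
  defines "E \<equiv> complex_embeddings :: ('k \<Rightarrow> complex) set"
  shows finite_complex_embeddings: "finite E"
    and complex_embeddings_nonempty: "E \<noteq> {}"
    and card_complex_embeddings_le: "card E \<le> number_field_degree TYPE('k)"
    and norm_ge_1: "\<And>a. algebraic_int a \<Longrightarrow> a \<noteq> 0 \<Longrightarrow> 1 \<le> (\<Prod>\<sigma>\<in>E. cmod (\<sigma> a))"
proof -
  obtain \<theta> :: 'k where gen: "rat_adjoin \<theta> = UNIV"
    by (rule primitive_element[OF K])
  obtain p where "p \<noteq> 0" "rat_eval p \<theta> = 0"
    using number_field_algebraic[OF K, of \<theta>] by blast
  then obtain f where f0: "f \<noteq> 0" and f: "prime_elem f" "\<And>g. rat_eval g \<theta> = 0 \<longleftrightarrow> f dvd g"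
    using rat_minpoly_exists[of p \<theta>] by blast
  define Z where "Z = {z::complex. rat_eval f z = 0}"
  have bij: "bij_betw (\<lambda>\<sigma>. \<sigma> \<theta>) E Z"
    unfolding E_def Z_def by (rule bij_betw_embeddings_roots[OF gen f(2)])
  have Z: "finite Z" "card Z = degree f"
    using finite_roots_rat[OF f0] card_complex_roots[OF f(1)] by (auto simp: Z_def)
  have deg: "degree f > 0"
    using f(1) is_unit_iff_degree[OF f0] by (auto simp: prime_elem_def)
  show "finite E"
    using bij_betw_finite[OF bij] Z by simp
  have card: "card E = degree f"
    using bij_betw_same_card[OF bij] Z by simp
  then show "E \<noteq> {}" using deg by auto
  \<comment> \<open>A relation between the powers of the generator below \<open>degree f\<close>
    would be a multiple of \<open>f\<close> of smaller degree.\<close>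
  have "degree f \<le> number_field_degree TYPE('k)"
  proof (rule number_field_independent_le[OF K, of "\<lambda>i. \<theta> ^ i"])
    fix c :: "nat \<Rightarrow> rat" assume c: "(\<Sum>i<degree f. of_rat (c i) * \<theta> ^ i) = 0"
    define g where "g = (\<Sum>i<degree f. monom (c i) i)"
    have dg: "degree g < degree f"
      using degree_sum_monom[OF deg] by (simp add: g_def)
    have "rat_eval g \<theta> = 0"
      using c by (subst rat_eval_eq_sum[OF dg]) (simp add: g_def coeff_sum_monom)
    then have "f dvd g"
      by (simp only: f(2))
    then have "g = 0"
      using dg dvd_imp_degree_le[of f g] by linarith
    then show "\<forall>i<degree f. c i = 0"
      using coeff_sum_monom[of c "degree f"] unfolding g_def by (metis coeff_0)
  qed
  then show "card E \<le> number_field_degree TYPE('k)" by (simp add: card)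
  obtain z where z: "bij_betw z {..<degree f} Z"
    using ex_bij_betw_nat_finite[OF Z(1)] Z(2) by (auto simp: atLeast0LessThan)
  fix a :: 'k assume a: "algebraic_int a" "a \<noteq> 0"
  obtain h where h: "a = rat_eval h \<theta>"
    using gen by (auto simp: rat_adjoin_def)
  have "(\<Prod>\<sigma>\<in>E. \<sigma> a) = (\<Prod>\<sigma>\<in>E. rat_eval h (\<sigma> \<theta>))"
    by (intro prod.cong) (auto simp: h E_def complex_embedding_rat_eval)
  also have "\<dots> = (\<Prod>w\<in>Z. rat_eval h w)"
    by (rule prod.reindex_bij_betw[OF bij])
  also have "\<dots> = (\<Prod>i<degree f. rat_eval h (z i))"
    by (rule prod.reindex_bij_betw[OF z, symmetric])
  also have "\<dots> \<in> \<rat>"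
    using z by (intro prod_conjugates_rational f(1)) (simp add: Z_def)
  finally have "(\<Prod>\<sigma>\<in>E. \<sigma> a) \<in> \<rat>" .
  moreover have "algebraic_int (\<Prod>\<sigma>\<in>E. \<sigma> a)"
    by (rule algebraic_int_prod) (simp add: complex_embedding_algebraic_int a(1) E_def)
  ultimately have "(\<Prod>\<sigma>\<in>E. \<sigma> a) \<in> \<int>"
    by (rule rational_algebraic_int_is_int[rotated])
  then obtain m where m: "(\<Prod>\<sigma>\<in>E. \<sigma> a) = of_int m" by (auto elim: Ints_cases)
  have "\<sigma> a \<noteq> 0" if "\<sigma> \<in> E" for \<sigma>
  proof -
    interpret field_hom \<sigma> using that by (intro field_hom_complex_embedding) (simp add: E_def)
    show ?thesis using a by simp
  qed
  then have "m \<noteq> 0"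
    using m \<open>finite E\<close> by auto
  then have "1 \<le> cmod (of_int m)" by simp
  then show "1 \<le> (\<Prod>\<sigma>\<in>E. cmod (\<sigma> a))"
    by (simp only: prod_norm m)
qed

section \<open>The absolute game on the unit interval\<close>

text \<open>The candidates are the two extreme centres of a ball of radius
  \<open>\<beta> * r\<close> inside the old one, clipped to the unit interval. They are more than
  \<open>4 * \<beta> * r\<close> apart; \<open>r < 2\<close> secures this when both are clipped. The
  distance \<open>2 * \<beta> * r\<close> is Alice's radius plus Bob's.\<close>

lemma exists_far_point:
  fixes b r \<beta> l :: real
  assumes "0 < \<beta>" "\<beta> < 1/8" "0 \<le> b" "b \<le> 1" "0 < r" "r < 2"
  shows "\<exists>c\<in>{0..1}. \<bar>c - b\<bar> \<le> r - \<beta> * r \<and> 2 * \<beta> * r < \<bar>c - l\<bar>"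
proof -
  define s where "s = \<beta> * r"
  have s: "s < r / 8" "0 < s" using assms by (simp_all add: s_def)
  define u where "u = max 0 (b - (r - s))"
  define w where "w = min 1 (b + (r - s))"
  have "w - u > 4 * s" "u \<in> {0..1}" "w \<in> {0..1}" "\<bar>u - b\<bar> \<le> r - s" "\<bar>w - b\<bar> \<le> r - s"
    using s assms(3-6) by (auto simp: u_def w_def min_def max_def)
  moreover from this(1) have "2 * s < \<bar>u - l\<bar> \<or> 2 * s < \<bar>w - l\<bar>"
    by linarith
  ultimately show ?thesis
    unfolding s_def by (metis mult.assoc)
qed

text \<open>A halving at a time when the radii are below twice a positive limit would undercut that
  limit.\<close>

lemma nested_halving_balls_converge:
  fixes b r :: "nat \<Rightarrow> real"
  assumes b: "\<And>n. b n \<in> {0..1}" and r: "\<And>n. 0 < r n"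
    and nested: "\<And>n. \<bar>b (Suc n) - b n\<bar> \<le> r n - r (Suc n)"
    and halving: "\<And>N. \<exists>n\<ge>N. r (Suc n) \<le> r n / 2"
  shows "r \<longlonglongrightarrow> 0" and "\<exists>x\<in>{0..1}. \<forall>n. \<bar>x - b n\<bar> \<le> r n"
proof -
  have mono: "r (Suc n) \<le> r n" for n
    using nested[of n] by linarith
  have dec: "decseq r"
    by (rule decseq_SucI) (rule mono)
  obtain L where L: "r \<longlonglongrightarrow> L" "\<And>n. L \<le> r n"
    using decseq_convergent[OF dec, of 0] r by (auto intro: less_imp_le)
  have "L \<ge> 0"
    using L(1) r by (intro LIMSEQ_le_const) (auto intro: less_imp_le)
  moreover have "\<not> L > 0"
  proof
    assume "L > 0"
    then have "eventually (\<lambda>n. r n < 2 * L) sequentially"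
      by (intro order_tendstoD(2)[OF L(1)]) simp
    then obtain N where N: "\<And>n. n \<ge> N \<Longrightarrow> r n < 2 * L"
      by (auto simp: eventually_sequentially)
    obtain n where "n \<ge> N" "r (Suc n) \<le> r n / 2"
      using halving by blast
    then show False using N[of n] L(2)[of "Suc n"] by linarith
  qed
  ultimately show r0: "r \<longlonglongrightarrow> 0" using L(1) by (simp add: not_less)
  have le: "\<bar>b m - b n\<bar> \<le> r n - r m" if "n \<le> m" for m n
    using that
  proof (induction m rule: dec_induct)
    case (step m)
    then show ?case using nested[of m] by linarith
  qed simp
  have "Cauchy b"
  proof (rule metric_CauchyI)
    fix e :: real assume "e > 0"
    then have "eventually (\<lambda>n. r n < e / 2) sequentially"
      by (intro order_tendstoD(2)[OF r0]) simp
    then obtain N where N: "r N < e / 2" by (auto simp: eventually_sequentially)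
    have "\<bar>b m - b N\<bar> < e / 2" if "m \<ge> N" for m
      using le[OF that] N r[of m] by linarith
    then show "\<exists>M. \<forall>m\<ge>M. \<forall>n\<ge>M. dist (b m) (b n) < e"
      by (intro exI[of _ N]) (smt (verit, best) dist_real_def field_sum_of_halves)
  qed
  then obtain x where x: "b \<longlonglongrightarrow> x"
    using convergent_eq_Cauchy by blast
  have "x \<in> {0..1}"
    by (rule closed_sequentially[OF _ b x]) simp
  moreover have "\<bar>x - b n\<bar> \<le> r n" for n
  proof (rule LIMSEQ_le_const2)
    show "(\<lambda>m. \<bar>b m - b n\<bar>) \<longlonglongrightarrow> \<bar>x - b n\<bar>"
      by (intro tendsto_intros x)
    show "\<exists>N. \<forall>m\<ge>N. \<bar>b m - b n\<bar> \<le> r n"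
      using le[of n] r by (intro exI[of _ n]) (smt (verit))
  qed
  ultimately show "\<exists>x\<in>{0..1}. \<forall>n. \<bar>x - b n\<bar> \<le> r n" by blast
qed

text \<open>In a ball of radius at least 2, Alice removes the point 0, which forces the next radius
  below 1. From then on she removes targets with the maximal radius. Removing the centre of the current
  ball forces Bob to halve his radius.\<close>

definition target_strategy ::
    "real \<Rightarrow> (nat \<Rightarrow> real \<times> real \<Rightarrow> real) \<Rightarrow> (real \<times> real) list \<Rightarrow> real set \<times> real" where
  "target_strategy \<beta> t Bs =
     (let B = last Bs in
      if snd B \<ge> 2 then ({0}, min ((1 - \<beta> * snd B) / 2) (\<beta> * snd B))
      else ({t (length Bs - 2) B}, \<beta> * snd B))"

text \<open>Reduces the game to sequences of real numbers: \<open>win\<close> describes the play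
  from Bob's second ball on, where Alice always removes with the full radius
  \<open>\<beta> * r\<close>.\<close>

lemma target_strategy_winning:
  fixes \<beta> :: real and t :: "nat \<Rightarrow> real \<times> real \<Rightarrow> real"
  assumes \<beta>: "0 < \<beta>" "\<beta> < 1/8"
    and t: "\<And>n b r. b \<in> {0..1} \<Longrightarrow> t n (b, r) \<in> {0..1}"
    and centre: "\<And>N. \<exists>n\<ge>N. \<forall>b r. t n (b, r) = b"
    and win: "\<And>b r x. (\<And>n. b n \<in> {0..1}) \<Longrightarrow> (\<And>n. 0 < r n) \<Longrightarrow> (\<And>n. \<beta> * r n \<le> r (Suc n)) \<Longrightarrow>
        (\<And>n. \<bar>b (Suc n) - b n\<bar> \<le> r n - r (Suc n)) \<Longrightarrow>
        (\<And>n. \<bar>b (Suc n) - t n (b n, r n)\<bar> > \<beta> * r n + r (Suc n)) \<Longrightarrow> r \<longlonglongrightarrow> 0 \<Longrightarrow>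
        x \<in> {0..1} \<Longrightarrow> (\<And>n. \<bar>x - b n\<bar> \<le> r n) \<Longrightarrow> x \<in> W"
  shows "winning_strategy {0..1} ((\<lambda>x. {x}) ` {0..1}) {0..1} \<beta> W (target_strategy \<beta> t)"
proof -
  let ?H = "(\<lambda>x::real. {x}) ` {0..1}"
  let ?s = "target_strategy \<beta> t"
  \<comment> \<open>The bound \<open>\<beta> * snd (last Bs) < 1\<close> stems from the opening
    rule: some second ball, of radius at least \<beta> times the first, has its centre farther than
    its radius from a point of the unit interval.\<close>
  have inv: "fst (last Bs) \<in> {0..1} \<and> 0 < snd (last Bs) \<and> \<beta> * snd (last Bs) < 1 \<and> Bs \<noteq> [] \<and>
      (length Bs \<ge> 2 \<longrightarrow> snd (last Bs) < 2)" if "bob_play ?H {0..1} \<beta> ?s Bs" for Bs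
    using that
  proof (induction rule: bob_play.induct)
    case (first B)
    then obtain A B' where A: "alice_move ?H \<beta> B A" and B': "bob_move {0..1} \<beta> B A B'"
      by (auto simp: bob_opening_def)
    obtain l where l: "fst A = {l}" "l \<in> {0..1}" using A by (auto simp: alice_move_def)
    have "snd A > 0" using A by (simp add: alice_move_def)
    moreover have "\<bar>fst B' - l\<bar> > snd A + snd B'" "\<beta> * snd B \<le> snd B'" "fst B' \<in> {0..1}"
      using B' l by (auto simp: bob_move_def dist_real_def)
    moreover have "\<bar>fst B' - l\<bar> \<le> 1" using l(2) \<open>fst B' \<in> {0..1}\<close> by auto
    ultimately have "\<beta> * snd B < 1" by linarith
    then show ?case using first by (simp add: bob_opening_def)
  next
    case (extend Bs B)
    let ?L = "last Bs"
    have B: "fst B \<in> {0..1}" "0 < snd B" "snd B \<le> snd ?L"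
      using extend by (auto simp: bob_move_def)
    have "\<beta> * snd B \<le> \<beta> * snd ?L" using B \<beta> by simp
    moreover have "snd B < 2"
    proof (cases "snd ?L \<ge> 2")
      case True
      then have "\<bar>fst B\<bar> > snd (?s Bs) + snd B" "snd (?s Bs) > 0"
        using extend \<beta> by (auto simp: bob_move_def target_strategy_def Let_def dist_real_def)
      then show ?thesis using B by auto
    qed (use B in simp)
    ultimately show ?case using B extend by simp
  qed
  have move: "alice_move ?H \<beta> (last Bs) (?s Bs) \<and> (\<exists>B. bob_move {0..1} \<beta> (last Bs) (?s Bs) B)"
    if play: "bob_play ?H {0..1} \<beta> ?s Bs" for Bs
  proof -
    obtain b r where L: "last Bs = (b, r)" by fastforce
    have I: "b \<in> {0..1}" "0 < r" "\<beta> * r < 1" using inv[OF play] L by auto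
    have \<beta>r: "\<beta> * r > 0" "\<beta> * r < r / 8" using \<beta> I by simp_all
    show ?thesis
    proof (cases "r \<ge> 2")
      case True
      \<comment> \<open>The removed radius around 0 is capped so that Bob may still answer with
        centre 1 and radius \<open>\<beta> * r\<close>.\<close>
      moreover have "min ((1 - \<beta> * r) / 2) (\<beta> * r) + \<beta> * r < 1"
        using I(3) by (simp add: min_def field_simps)
      ultimately have "bob_move {0..1} \<beta> (last Bs) (?s Bs) (1, \<beta> * r)"
        using I \<beta>r by (auto simp: bob_move_def ball_le_def L target_strategy_def dist_real_def)
      moreover have "alice_move ?H \<beta> (last Bs) (?s Bs)"
        using I \<beta>r True by (auto simp: alice_move_def L target_strategy_def)
      ultimately show ?thesis by blast
    next
      case False
      let ?l = "t (length Bs - 2) (b, r)"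
      obtain c where c: "c \<in> {0..1}" "\<bar>c - b\<bar> \<le> r - \<beta> * r" "2 * \<beta> * r < \<bar>c - ?l\<bar>"
        using exists_far_point[OF \<beta>, of b r ?l] I False by auto
      then have "bob_move {0..1} \<beta> (last Bs) (?s Bs) (c, \<beta> * r)"
        using I \<beta> \<beta>r False by (auto simp: bob_move_def ball_le_def L target_strategy_def dist_real_def)
      moreover have "alice_move ?H \<beta> (last Bs) (?s Bs)"
        using I \<beta>r False t[OF I(1)] by (auto simp: alice_move_def L target_strategy_def)
      ultimately show ?thesis by blast
    qed
  qed
  have "W \<inter> {0..1} \<inter> (\<Inter>n. ball_set {0..1} (B n)) \<noteq> {}"
    if play: "\<forall>n. bob_play ?H {0..1} \<beta> ?s (map B [0..<Suc n])" for B
  proof -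
    define b r where "b = (\<lambda>n. fst (B n))" and "r = (\<lambda>n. snd (B n))"
    have B: "B n = (b n, r n)" for n by (simp add: b_def r_def)
    have bm: "bob_move {0..1} \<beta> (B n) (?s (map B [0..<Suc n])) (B (Suc n))" for n
    proof -
      have "bob_play ?H {0..1} \<beta> ?s (map B [0..<Suc n] @ [B (Suc n)])"
        using play[rule_format, of "Suc n"] by simp
      then show ?thesis
        by (cases rule: bob_play.cases) auto
    qed
    have b: "b n \<in> {0..1}" and r: "0 < r n" for n
      using inv[OF play[rule_format, of n]] by (simp_all add: b_def r_def)
    have r2: "r (Suc n) < 2" for n
      using inv[OF play[rule_format, of "Suc n"]] by (simp add: r_def)
    have beta: "\<beta> * r n \<le> r (Suc n)" and nested: "\<bar>b (Suc n) - b n\<bar> \<le> r n - r (Suc n)" for n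
      using bm[of n] by (auto simp: bob_move_def ball_le_def B dist_real_def)
    \<comment> \<open>Because of \<open>length Bs - 2\<close>, target \<open>n\<close> answers ball
      \<open>n + 1\<close>; hence \<open>win\<close> is applied to the shifted sequences.\<close>
    have far: "\<bar>b (Suc (Suc n)) - t n (b (Suc n), r (Suc n))\<bar> > \<beta> * r (Suc n) + r (Suc (Suc n))" for n
      using bm[of "Suc n"] r2[of n] by (simp add: bob_move_def B dist_real_def target_strategy_def)
    have "\<exists>n\<ge>N. r (Suc n) \<le> r n / 2" for N
    proof -
      obtain n where n: "n \<ge> N" "\<forall>b r. t n (b, r) = b" using centre by blast
      have "\<beta> * r (Suc n) > 0" using \<beta> r by simp
      then have "r (Suc (Suc n)) \<le> r (Suc n) / 2"
        using far[of n] n(2) nested[of "Suc n"] by (smt (verit) field_sum_of_halves)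
      then show ?thesis using n(1) by (intro exI[of _ "Suc n"]) simp
    qed
    note conv = nested_halving_balls_converge[OF b r nested this]
    obtain x where x: "x \<in> {0..1}" "\<And>n. \<bar>x - b n\<bar> \<le> r n"
      using conv(2) by blast
    have "x \<in> W"
      using LIMSEQ_Suc[OF conv(1)]
      by (intro win[of "\<lambda>n. b (Suc n)" "\<lambda>n. r (Suc n)" x]) (use b r beta nested far x in auto)
    moreover have "x \<in> ball_set {0..1} (B n)" for n
      using x by (simp add: ball_set_def B dist_real_def abs_minus_commute)
    ultimately show ?thesis using x(1) by blast
  qed
  then show ?thesis
    unfolding winning_strategy_def using move by blast
qed

section \<open>Expanding curves\<close>

lemma lipschitz_if_vector_derivative_bound:
  fixes f :: "real \<Rightarrow> 'a::real_normed_vector"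
  assumes "convex S" "\<And>x. x \<in> S \<Longrightarrow> (f has_vector_derivative f' x) (at x within S)"
    and "\<And>x. x \<in> S \<Longrightarrow> norm (f' x) \<le> B" "x \<in> S" "y \<in> S"
  shows "norm (f x - f y) \<le> B * \<bar>x - y\<bar>"
proof -
  have "onorm (\<lambda>h. h *\<^sub>R f' x) \<le> B" if "x \<in> S" for x
    using assms(3)[OF that] by (intro onorm_le) (simp add: mult.commute[of B] mult_left_mono)
  then show ?thesis
    using differentiable_bound[of S f "\<lambda>x h. h *\<^sub>R f' x" B x y] assms
    by (simp add: has_vector_derivative_def)
qed

text \<open>With \<open>a = f' x\<close>, subtracting the linear part leaves a function with
  derivative at most \<open>norm a / 2\<close> near \<open>x\<close>, so \<open>f\<close> itself
  expands by at least \<open>norm a / 2\<close>. The constant is rounded up to a natural number so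
  that a least one can be chosen later.\<close>

lemma C1_expanding_near:
  fixes f :: "real \<Rightarrow> 'a::real_normed_vector"
  assumes S: "convex S" and d: "\<And>x. x \<in> S \<Longrightarrow> (f has_vector_derivative f' x) (at x within S)"
    and c: "continuous_on S f'" and x: "x \<in> S" "f' x \<noteq> 0"
  obtains \<delta> k where "\<delta> > 0" "\<And>y z. y \<in> S \<Longrightarrow> z \<in> S \<Longrightarrow> \<bar>y - x\<bar> < \<delta> \<Longrightarrow> \<bar>z - x\<bar> < \<delta> \<Longrightarrow>
     \<bar>y - z\<bar> \<le> real k * norm (f y - f z)"
proof -
  define a where "a = f' x"
  have a: "norm a > 0" using x by (simp add: a_def)
  obtain \<delta> where \<delta>: "\<delta> > 0" "\<And>w. w \<in> S \<Longrightarrow> dist w x < \<delta> \<Longrightarrow> dist (f' w) (f' x) < norm a / 2"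
    using c[unfolded continuous_on_iff, rule_format, OF x(1), of "norm a / 2"] a by auto
  obtain k :: nat where k: "2 / norm a \<le> real k"
    using real_arch_simple by blast
  have "\<bar>y - z\<bar> \<le> real k * norm (f y - f z)"
    if y: "y \<in> S" "\<bar>y - x\<bar> < \<delta>" and z: "z \<in> S" "\<bar>z - x\<bar> < \<delta>" for y z
  proof -
    let ?U = "S \<inter> ball x \<delta>"
    define dF where "dF = f y - f z"
    define dL where "dL = (y - z) *\<^sub>R a"
    have "norm ((f y - y *\<^sub>R a) - (f z - z *\<^sub>R a)) \<le> norm a / 2 * \<bar>y - z\<bar>"
    proof (rule lipschitz_if_vector_derivative_bound[where S = ?U and f' = "\<lambda>w. f' w - a"])
      show "convex ?U" using S by (intro convex_Int) auto
      show "((\<lambda>w. f w - w *\<^sub>R a) has_vector_derivative f' w - a) (at w within ?U)" if "w \<in> ?U" for w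
        using that by (auto intro!: derivative_eq_intros has_vector_derivative_within_subset[OF d])
      show "norm (f' w - a) \<le> norm a / 2" if "w \<in> ?U" for w
        using \<delta>(2)[of w] that by (simp add: dist_norm a_def abs_minus_commute less_imp_le)
    qed (use y z in \<open>auto simp: dist_real_def\<close>)
    moreover have "(f y - y *\<^sub>R a) - (f z - z *\<^sub>R a) = dF - dL"
      by (simp add: algebra_simps dF_def dL_def)
    ultimately have "norm (dF - dL) \<le> norm a / 2 * \<bar>y - z\<bar>"
      by (simp only:)
    moreover have "norm dL - norm dF \<le> norm (dF - dL)"
      by (metis norm_minus_commute norm_triangle_ineq2)
    moreover have "norm dL = norm a * \<bar>y - z\<bar>"
      by (simp add: dL_def)
    ultimately have "norm a / 2 * \<bar>y - z\<bar> \<le> norm dF"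
      by linarith
    then have "norm a / 2 * \<bar>y - z\<bar> \<le> norm (f y - f z)"
      by (simp only: dF_def)
    then have "\<bar>y - z\<bar> \<le> 2 / norm a * norm (f y - f z)"
      using a by (simp add: field_simps)
    also have "\<dots> \<le> real k * norm (f y - f z)"
      using k by (intro mult_right_mono) auto
    finally show ?thesis .
  qed
  with \<delta>(1) show ?thesis using that by blast
qed

section \<open>Approximation by fractions\<close>

locale number_field_places =
  fixes \<iota> :: "('k::field_char_0 \<Rightarrow> real) \<Rightarrow> 'k \<Rightarrow> complex"
  assumes number_field: "number_field TYPE('k)" and \<iota>: "place_embeddings \<iota>"
begin

abbreviation S :: "('k \<Rightarrow> real) set" where "S \<equiv> archimedean_places"
abbreviation E :: "('k \<Rightarrow> complex) set" where "E \<equiv> complex_embeddings"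

text \<open>Counting embeddings makes a complex place count twice, as in the hypothesis of the
  theorem.\<close>

definition weight :: "('k \<Rightarrow> real) set \<Rightarrow> nat" where
  "weight T = card {\<sigma> \<in> E. (\<lambda>x. cmod (\<sigma> x)) \<in> T}"

definition max_abs :: "('k \<Rightarrow> real) set \<Rightarrow> 'k \<Rightarrow> real" where
  "max_abs T q = Max ((\<lambda>v. v q) ` T)"

definition height :: "('k \<Rightarrow> real) set \<Rightarrow> 'k \<Rightarrow> real" where
  "height T q = max_abs S q * max_abs T q"

text \<open>Failure of the inequality in \<open>badly_approximable\<close> for the constant
  \<open>c\<close>, with the maximum over the places unfolded.\<close>

definition approx :: "real \<Rightarrow> (('k \<Rightarrow> real) \<Rightarrow> complex) \<Rightarrow> 'k \<Rightarrow> 'k \<Rightarrow> bool" where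
  "approx c y p q \<longleftrightarrow> algebraic_int p \<and> algebraic_int q \<and> q \<noteq> 0 \<and>
     (\<forall>v\<in>S. cmod (\<iota> v q * y v + \<iota> v p) \<le> c / max_abs S q)"

lemma finite_S: "finite S" and S_nonempty: "S \<noteq> {}" and finite_E: "finite E" and card_E_pos: "card E > 0"
  using finite_complex_embeddings[OF number_field] complex_embeddings_nonempty[OF number_field]
  by (auto simp: archimedean_places_def card_gt_0_iff)

lemma embedding: "v \<in> S \<Longrightarrow> \<iota> v \<in> E" and cmod_embedding: "v \<in> S \<Longrightarrow> cmod (\<iota> v x) = v x"
  using \<iota> by (auto simp: place_embeddings_def)

lemma embedding_hom:
  assumes "v \<in> S"
  shows "\<iota> v (a + b) = \<iota> v a + \<iota> v b" "\<iota> v (a - b) = \<iota> v a - \<iota> v b" "\<iota> v (- a) = - \<iota> v a"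
    "\<iota> v (a * b) = \<iota> v a * \<iota> v b" "\<iota> v (a / b) = \<iota> v a / \<iota> v b" "\<iota> v a = 0 \<longleftrightarrow> a = 0"
proof -
  interpret field_hom "\<iota> v" by (rule field_hom_complex_embedding[OF embedding[OF assms]])
  show "\<iota> v (a + b) = \<iota> v a + \<iota> v b" "\<iota> v (a - b) = \<iota> v a - \<iota> v b" "\<iota> v (- a) = - \<iota> v a"
    "\<iota> v (a * b) = \<iota> v a * \<iota> v b" "\<iota> v (a / b) = \<iota> v a / \<iota> v b" "\<iota> v a = 0 \<longleftrightarrow> a = 0"
    by (simp_all add: hom_add hom_minus hom_uminus hom_mult hom_div)
qed

lemma place_nonneg: "v \<in> S \<Longrightarrow> 0 \<le> v x"
  by (simp flip: cmod_embedding)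

lemma place_pos: "v \<in> S \<Longrightarrow> q \<noteq> 0 \<Longrightarrow> 0 < v q"
  by (simp add: embedding_hom(6) flip: cmod_embedding)

lemma place_in_S: "\<sigma> \<in> E \<Longrightarrow> (\<lambda>x. cmod (\<sigma> x)) \<in> S"
  by (auto simp: archimedean_places_def)

lemma nonempty_if_weight: "card E \<le> 2 * weight T \<Longrightarrow> T \<noteq> {}"
  using card_E_pos by (auto simp: weight_def)

lemma max_abs_ge: "T \<subseteq> S \<Longrightarrow> v \<in> T \<Longrightarrow> v q \<le> max_abs T q"
  unfolding max_abs_def using finite_S by (intro Max_ge) (auto intro: finite_subset)

lemma max_abs_attained:
  assumes "T \<subseteq> S" "T \<noteq> {}"
  obtains v where "v \<in> T" "v q = max_abs T q"
proof -
  have "Max ((\<lambda>v. v q) ` T) \<in> (\<lambda>v. v q) ` T"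
    using assms finite_subset[OF _ finite_S] by (intro Max_in) auto
  then obtain v where "v \<in> T" "Max ((\<lambda>v. v q) ` T) = v q"
    by (rule imageE)
  then show ?thesis using that by (simp add: max_abs_def)
qed

lemma max_abs_pos:
  assumes "T \<subseteq> S" "T \<noteq> {}" "q \<noteq> 0"
  shows "0 < max_abs T q"
proof -
  obtain v where "v \<in> T" "v q = max_abs T q" by (rule max_abs_attained[OF assms(1,2)])
  then show ?thesis using place_pos[of v q] assms by auto
qed

lemma max_abs_mono:
  assumes "T \<subseteq> S" "T \<noteq> {}"
  shows "max_abs T q \<le> max_abs S q"
proof -
  obtain v where "v \<in> T" "v q = max_abs T q" by (rule max_abs_attained[OF assms])
  then show ?thesis using max_abs_ge[of S v q] assms by auto
qed

text \<open>The bounds multiply to \<open>e ^ card E\<close> times \<open>u\<close> to the exponent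
  \<open>2 * weight T - card E\<close>. The weight condition makes this exponent nonnegative, so the
  norm is below 1.\<close>

lemma algebraic_int_eq_0:
  assumes a: "algebraic_int a" and T: "card E \<le> 2 * weight T"
    and u: "0 < u" "u \<le> 1" and e: "0 \<le> e" "e < 1"
    and small: "\<And>v. v \<in> S \<Longrightarrow> v \<in> T \<Longrightarrow> v a \<le> e * u" "\<And>v. v \<in> S \<Longrightarrow> v \<notin> T \<Longrightarrow> v a \<le> e / u"
  shows "a = 0"
proof (rule ccontr)
  assume "a \<noteq> 0"
  let ?P = "\<lambda>\<sigma>. (\<lambda>x. cmod (\<sigma> x)) \<in> T"
  let ?w = "weight T" and ?n = "card E"
  have n: "?n = ?w + card {\<sigma> \<in> E. \<not> ?P \<sigma>}"
  proof -
    have "?n = card ({\<sigma> \<in> E. ?P \<sigma>} \<union> {\<sigma> \<in> E. \<not> ?P \<sigma>})"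
      by (rule arg_cong[of _ _ card]) auto
    also have "\<dots> = ?w + card {\<sigma> \<in> E. \<not> ?P \<sigma>}"
      unfolding weight_def using finite_E by (intro card_Un_disjoint) auto
    finally show ?thesis .
  qed
  have "1 \<le> (\<Prod>\<sigma>\<in>E. cmod (\<sigma> a))"
    by (rule norm_ge_1[OF number_field a \<open>a \<noteq> 0\<close>])
  also have "\<dots> \<le> (\<Prod>\<sigma>\<in>E. if ?P \<sigma> then e * u else e / u)"
    using small place_in_S by (intro prod_mono) auto
  also have "\<dots> = (e * u) ^ ?w * (e / u) ^ (?n - ?w)"
    using n by (simp add: prod.If_cases[OF finite_E] weight_def Int_def Collect_neg_eq[symmetric])
  also have "\<dots> = e ^ ?n * (u ^ ?w / u ^ (?n - ?w))"
    using n by (simp add: power_mult_distrib power_divide flip: power_add)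
  also have "\<dots> \<le> e ^ ?n * 1"
  proof (intro mult_left_mono)
    have "u ^ ?w \<le> u ^ (?n - ?w)"
      using T n u by (intro power_decreasing) auto
    then show "u ^ ?w / u ^ (?n - ?w) \<le> 1" using u by simp
  qed (use e in simp)
  also have "\<dots> < 1"
    using e card_E_pos by (simp add: power_less_one_iff)
  finally show False by simp
qed

text \<open>With \<open>a\<close>, \<open>b\<close> the maxima of \<open>q\<close> over
  \<open>S\<close> and \<open>T\<close>, the choice \<open>u = sqrt (b / a)\<close>,
  \<open>e = sqrt (a * b)\<close> gives \<open>e * u = b\<close> and \<open>e / u = a\<close>; here
  \<open>e < 1\<close> exactly if the height is.\<close>

lemma height_ge_1:
  assumes q: "algebraic_int q" "q \<noteq> 0" and T: "T \<subseteq> S" "card E \<le> 2 * weight T"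
  shows "1 \<le> height T q"
proof (rule ccontr)
  assume less: "\<not> 1 \<le> height T q"
  have ne: "T \<noteq> {}" using nonempty_if_weight T by blast
  define a b where "a = max_abs S q" and "b = max_abs T q"
  have ab: "0 < b" "0 < a" "b \<le> a"
    using max_abs_pos max_abs_mono T(1) ne q S_nonempty by (auto simp: a_def b_def)
  have "q = 0"
  proof (rule algebraic_int_eq_0[OF q(1) T(2), of "sqrt (b / a)" "sqrt (a * b)"])
    show "sqrt (a * b) < 1" using less by (simp add: height_def a_def b_def)
    show "v q \<le> sqrt (a * b) * sqrt (b / a)" if "v \<in> S" "v \<in> T" for v
    proof -
      have "sqrt (a * b) * sqrt (b / a) = sqrt (b\<^sup>2)"
        using ab by (simp add: power2_eq_square flip: real_sqrt_mult)
      then show ?thesis using max_abs_ge[OF T(1) that(2)] ab by (simp add: b_def)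
    qed
    show "v q \<le> sqrt (a * b) / sqrt (b / a)" if "v \<in> S" "v \<notin> T" for v
    proof -
      have "sqrt (a * b) / sqrt (b / a) = sqrt (a\<^sup>2)"
        using ab by (simp add: power2_eq_square flip: real_sqrt_divide)
      then show ?thesis using max_abs_ge[OF order_refl that(1)] ab by (simp add: a_def)
    qed
  qed (use ab in auto)
  then show False using q by simp
qed

text \<open>Let \<open>A\<close>, \<open>B\<close> and \<open>A'\<close>, \<open>B'\<close> be the
  maxima of \<open>q\<close> and \<open>q'\<close> over \<open>S\<close>, \<open>T\<close>. The
  choice \<open>u = R / (A * A')\<close> balances the displacement term: on \<open>T\<close> it is
  at most \<open>B * B' * D\<close>, which the heights bound by \<open>D * L^2 * R * u\<close>;
  elsewhere it is at most \<open>A * A' * D = D * R / u\<close>. The approximation errors contribute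
  the part \<open>2 * c * L\<close> of \<open>e\<close>.\<close>

lemma approx_same_ratio:
  assumes T: "T \<subseteq> S" "card E \<le> 2 * weight T"
    and a: "approx c y p q" "approx c y' p' q'"
    and near: "\<And>v. v \<in> S \<Longrightarrow> cmod (y v - y' v) \<le> D"
    and c: "0 \<le> c" "0 \<le> D" and R: "0 < R" "1 \<le> L"
    and h: "R \<le> height T q" "height T q \<le> L * R" "R \<le> height T q'" "height T q' \<le> L * R"
    and small: "2 * c * L + D * L\<^sup>2 * R < 1"
  shows "q * p' = q' * p"
proof -
  have q: "algebraic_int p" "algebraic_int q" "q \<noteq> 0" "algebraic_int p'" "algebraic_int q'" "q' \<noteq> 0"
    using a by (auto simp: approx_def)
  have ne: "T \<noteq> {}" using nonempty_if_weight T by blast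
  define A B A' B' where "A = max_abs S q" "B = max_abs T q" "A' = max_abs S q'" "B' = max_abs T q'"
  note defs = this
  have pos: "0 < A" "0 < B" "B \<le> A" "0 < A'" "0 < B'" "B' \<le> A'"
    using max_abs_pos max_abs_mono T(1) ne q S_nonempty by (auto simp: defs)
  have h': "R \<le> A * B" "A * B \<le> L * R" "R \<le> A' * B'" "A' * B' \<le> L * R"
    using h by (simp_all add: height_def defs)
  have R2: "R \<le> A * A" "R \<le> A' * A'"
    using h'(1,3) mult_left_mono[OF pos(3), of A] mult_left_mono[OF pos(6), of A'] pos by linarith+
  \<comment> \<open>This gives \<open>u \<le> 1\<close>. It holds because \<open>T\<close> is part
    of \<open>S\<close>, so each height is at most the square of the maximum over
    \<open>S\<close>.\<close>
  have RAA: "R \<le> A * A'"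
  proof (rule power2_le_imp_le)
    have "R * R \<le> (A * A) * (A' * A')" using R2 R by (intro mult_mono) auto
    then show "R\<^sup>2 \<le> (A * A')\<^sup>2" by (simp add: power2_eq_square algebra_simps)
  qed (use pos in simp)
  define u where "u = R / (A * A')"
  have u: "0 < u" "u \<le> 1" using RAA pos R by (auto simp: u_def)
  define e where "e = 2 * c * L + D * L\<^sup>2 * R"
  have diff: "v (q * p' - q' * p) \<le> v q * (c / A') + v q' * (c / A) + v q * v q' * D" if v: "v \<in> S" for v
  proof -
    have tri: "cmod (a - b + d) \<le> cmod a + cmod b + cmod d" for a b d
      using norm_triangle_ineq[of "a - b" d] norm_triangle_ineq4[of a b] by linarith
    have "v (q * p' - q' * p) = cmod (\<iota> v (q * p' - q' * p))"
      by (simp only: cmod_embedding[OF v])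
    \<comment> \<open>Two approximation errors plus the displacement of the curve between the two
      parameters.\<close>
    also have "\<iota> v (q * p' - q' * p) = \<iota> v q * (\<iota> v q' * y' v + \<iota> v p') - \<iota> v q' * (\<iota> v q * y v + \<iota> v p)
        + \<iota> v q * \<iota> v q' * (y v - y' v)"
      by (simp add: embedding_hom[OF v] algebra_simps)
    also have "cmod \<dots> \<le> cmod (\<iota> v q * (\<iota> v q' * y' v + \<iota> v p')) + cmod (\<iota> v q' * (\<iota> v q * y v + \<iota> v p))
        + cmod (\<iota> v q * \<iota> v q' * (y v - y' v))"
      by (rule tri)
    also have "\<dots> \<le> v q * (c / A') + v q' * (c / A) + v q * v q' * D"
      unfolding norm_mult cmod_embedding[OF v]
      using a v near[OF v] place_nonneg[OF v] by (intro add_mono mult_left_mono) (auto simp: approx_def defs)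
    finally show ?thesis .
  qed
  have "q * p' - q' * p = 0"
  proof (rule algebraic_int_eq_0[OF _ T(2) u, of _ e])
    show "algebraic_int (q * p' - q' * p)"
      using q by (intro algebraic_int_diff algebraic_int_mult)
    show "0 \<le> e" "e < 1" using c R small by (auto simp: e_def)
    show "v (q * p' - q' * p) \<le> e * u" if v: "v \<in> S" "v \<in> T" for v
    proof -
      have vq: "v q \<le> B" "v q' \<le> B'" using max_abs_ge[OF T(1) v(2)] by (simp_all add: defs)
      have "v q * (c / A') + v q' * (c / A) + v q * v q' * D \<le> B * (c / A') + B' * (c / A) + B * B' * D"
        using vq pos c place_nonneg[OF v(1)] by (intro add_mono mult_mono) auto
      also have "\<dots> = (c * (A * B) + c * (A' * B') + (A * B) * (A' * B') * D) / (A * A')"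
      proof -
        have "B * (c / A') = c * (A * B) / (A * A')" "B' * (c / A) = c * (A' * B') / (A * A')"
          "B * B' * D = (A * B) * (A' * B') * D / (A * A')"
          using pos by (simp_all add: divide_simps)
        then show ?thesis by (simp only: add_divide_distrib)
      qed
      also have "\<dots> \<le> (c * (L * R) + c * (L * R) + (L * R) * (L * R) * D) / (A * A')"
      proof (intro divide_right_mono add_mono)
        show "c * (A * B) \<le> c * (L * R)" "c * (A' * B') \<le> c * (L * R)"
          using h' c by (auto intro: mult_left_mono)
        have "(A * B) * (A' * B') \<le> (L * R) * (L * R)"
          using h' pos R by (intro mult_mono[OF h'(2,4)]) auto
        then show "(A * B) * (A' * B') * D \<le> (L * R) * (L * R) * D"
          using c by (intro mult_right_mono)
      qed (use pos in simp)
      also have "\<dots> = e * u"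
        by (simp add: e_def u_def algebra_simps power2_eq_square add_divide_distrib)
      finally show ?thesis using diff[OF v(1)] by simp
    qed
    show "v (q * p' - q' * p) \<le> e / u" if v: "v \<in> S" "v \<notin> T" for v
    proof -
      have vq: "v q \<le> A" "v q' \<le> A'" using max_abs_ge[OF order_refl v(1)] by (simp_all add: defs)
      have "v q * (c / A') + v q' * (c / A) + v q * v q' * D \<le> A * (c / A') + A' * (c / A) + A * A' * D"
        using vq pos c place_nonneg[OF v(1)] by (intro add_mono mult_mono) auto
      also have "\<dots> = (c * (A * A) + c * (A' * A')) / (A * A') + A * A' * D"
      proof -
        have "A * (c / A') = c * (A * A) / (A * A')" "A' * (c / A) = c * (A' * A') / (A * A')"
          using pos by simp_all
        then show ?thesis by (simp only: add_divide_distrib)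
      qed
      also have "\<dots> \<le> (2 * c + D * R) / u"
      proof -
        \<comment> \<open>\<open>k\<close> is \<open>1 / u\<close>; the ratios \<open>A / A'\<close>
          and \<open>A' / A\<close> are at most \<open>k\<close> since both squares are at least
          \<open>R\<close>.\<close>
        define k where "k = A * A' / R"
        have Rk: "R * k = A * A'" using R by (simp add: k_def)
        have "A * A' / (A' * A') \<le> k"
          unfolding k_def by (rule divide_left_mono[OF R2(2)]) (use pos R in simp_all)
        moreover have "A * A' / (A * A) \<le> k"
          unfolding k_def by (rule divide_left_mono[OF R2(1)]) (use pos R in simp_all)
        ultimately have 1: "A / A' \<le> k" "A' / A \<le> k"
          using pos by simp_all
        have "(c * (A * A) + c * (A' * A')) / (A * A') = c * (A / A') + c * (A' / A)"
          using pos by (simp add: add_divide_distrib)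
        also have "\<dots> \<le> c * k + c * k"
          using 1 c by (intro add_mono mult_left_mono) auto
        also have "c * k + c * k + A * A' * D = (2 * c + D * R) * k"
          unfolding Rk[symmetric] by (simp add: algebra_simps)
        also have "\<dots> = (2 * c + D * R) / u"
          by (simp add: u_def k_def)
        finally show ?thesis by simp
      qed
      also have "\<dots> \<le> e / u"
      proof (intro divide_right_mono)
        have "2 * c * 1 \<le> 2 * c * L" using c R by (intro mult_left_mono) auto
        moreover have "D * 1 * R \<le> D * L\<^sup>2 * R"
          using c R one_le_power[of L 2] by (intro mult_right_mono mult_left_mono) simp_all
        ultimately show "2 * c + D * R \<le> e" by (simp add: e_def)
      qed (use u in simp)
      finally show ?thesis using diff[OF v(1)] by simp
    qed
  qed
  then show ?thesis by simp
qed

text \<open>Dividing by \<open>q\<close> at a place where it attains its maximum over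
  \<open>T\<close> turns the denominator of the error bound into the height.\<close>

lemma approx_at_max_place:
  assumes v: "v \<in> S" and q: "v q = max_abs T q" and a: "approx c y p q"
  shows "height T q * cmod (y v + \<iota> v (p / q)) \<le> c"
proof -
  have q0: "q \<noteq> 0" using a by (simp add: approx_def)
  have pos: "0 < max_abs S q" using max_abs_pos[OF order_refl S_nonempty q0] .
  have "\<iota> v q * y v + \<iota> v p = \<iota> v q * (y v + \<iota> v (p / q))"
    using q0 embedding_hom(6)[OF v, of q] by (simp add: embedding_hom(5)[OF v] distrib_left)
  then have "v q * cmod (y v + \<iota> v (p / q)) = cmod (\<iota> v q * y v + \<iota> v p)"
    by (simp add: norm_mult cmod_embedding[OF v])
  also have "\<dots> \<le> c / max_abs S q" using a v by (simp add: approx_def)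
  finally have "max_abs S q * (v q * cmod (y v + \<iota> v (p / q))) \<le> max_abs S q * (c / max_abs S q)"
    using pos by (intro mult_left_mono) simp_all
  also have "\<dots> = c" using pos by simp
  finally show ?thesis
    by (simp only: height_def q mult.assoc)
qed

text \<open>A complex place supplies \<open>\<iota> v\<close> and its conjugate, which differ since
  otherwise the closure of the image would be real. A real place supplies
  \<open>\<iota> v\<close>.\<close>

lemma weight_ge:
  assumes "T \<subseteq> S"
  shows "card (real_places \<iota> T) + 2 * card (complex_places \<iota> T) \<le> weight T"
proof -
  let ?R = "real_places \<iota> T" and ?C = "complex_places \<iota> T"
  have sub: "?R \<subseteq> S" "?C \<subseteq> S" "finite ?R" "finite ?C"
    using assms finite_S by (auto simp: real_places_def complex_places_def intro: finite_subset)
  have disj: "?R \<inter> ?C = {}"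
  proof -
    have "\<i> \<notin> \<real>" by (simp add: complex_is_Real_iff)
    then have "(\<real> :: complex set) \<noteq> UNIV" by blast
    then show ?thesis by (auto simp: real_places_def complex_places_def)
  qed
  define j where "j v = (\<lambda>x. cnj (\<iota> v x))" for v
  \<comment> \<open>\<open>pl\<close> recovers the place from an embedding. As a left inverse of
    \<open>\<iota>\<close> and of \<open>j\<close> it yields injectivity, and it reduces the
    disjointness claims to a single place.\<close>
  define pl :: "('k \<Rightarrow> complex) \<Rightarrow> 'k \<Rightarrow> real" where "pl \<sigma> = (\<lambda>x. cmod (\<sigma> x))" for \<sigma>
  have place: "pl (\<iota> v) = v" "pl (j v) = v" if "v \<in> S" for v
    using cmod_embedding[OF that] by (auto simp: j_def pl_def)
  have inj: "inj_on \<iota> ?R" "inj_on \<iota> ?C" "inj_on j ?C"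
    using place sub by (auto intro!: inj_on_inverseI[of _ pl])
  have jE: "j v \<in> E" if "v \<in> S" for v
    using embedding[OF that] by (auto simp: j_def complex_embeddings_def)
  have disj1: "\<iota> ` ?R \<inter> \<iota> ` ?C = {}"
  proof (rule ccontr)
    assume "\<iota> ` ?R \<inter> \<iota> ` ?C \<noteq> {}"
    then obtain v w where vw: "v \<in> ?R" "w \<in> ?C" "\<iota> v = \<iota> w" by auto
    then have "v \<in> S" "w \<in> S" using sub by blast+
    moreover have "pl (\<iota> v) = pl (\<iota> w)" by (simp only: vw(3))
    ultimately have "v = w" by (simp only: place)
    then show False using vw disj by auto
  qed
  have disj2: "j ` ?C \<inter> (\<iota> ` ?R \<union> \<iota> ` ?C) = {}"
  proof (rule ccontr)
    assume "j ` ?C \<inter> (\<iota> ` ?R \<union> \<iota> ` ?C) \<noteq> {}"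
    then obtain v w where vw: "v \<in> ?C" "w \<in> ?R \<union> ?C" "j v = \<iota> w" by auto
    then have "v \<in> S" "w \<in> S" using sub by blast+
    moreover have "pl (j v) = pl (\<iota> w)" by (simp only: vw(3))
    ultimately have "v = w" by (simp only: place)
    then have "\<iota> v x \<in> \<real>" for x
      using fun_cong[OF vw(3), of x] \<open>v = w\<close> by (simp add: j_def Reals_cnj_iff)
    then have "closure (range (\<iota> v)) \<subseteq> \<real>"
      by (intro closure_minimal closed_complex_Reals) auto
    moreover have "closure (range (\<iota> v)) = UNIV"
      using vw(1) by (simp add: complex_places_def completion_def)
    ultimately have "\<i> \<in> \<real>" by (metis UNIV_I subsetD)
    then show False by (simp add: complex_is_Real_iff)
  qed
  have "card ?R + 2 * card ?C = card (j ` ?C \<union> (\<iota> ` ?R \<union> \<iota> ` ?C))"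
  proof -
    have "card (j ` ?C \<union> (\<iota> ` ?R \<union> \<iota> ` ?C)) = card (j ` ?C) + card (\<iota> ` ?R \<union> \<iota> ` ?C)"
      by (rule card_Un_disjoint) (use sub disj2 in auto)
    also have "card (\<iota> ` ?R \<union> \<iota> ` ?C) = card (\<iota> ` ?R) + card (\<iota> ` ?C)"
      by (rule card_Un_disjoint) (use sub disj1 in auto)
    finally show ?thesis
      by (simp only: card_image inj)
  qed
  also have "\<dots> \<le> weight T"
    unfolding weight_def
  proof (rule card_mono)
    show "j ` ?C \<union> (\<iota> ` ?R \<union> \<iota> ` ?C) \<subseteq> {\<sigma> \<in> E. (\<lambda>x. cmod (\<sigma> x)) \<in> T}"
    proof
      fix \<sigma> assume "\<sigma> \<in> j ` ?C \<union> (\<iota> ` ?R \<union> \<iota> ` ?C)"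
      then obtain v where v: "v \<in> T" "\<sigma> = \<iota> v \<or> \<sigma> = j v"
        unfolding real_places_def complex_places_def by blast
      then have "v \<in> S" using assms by blast
      then have "\<sigma> \<in> E" "pl \<sigma> = v"
        using v(2) place jE embedding by auto
      then show "\<sigma> \<in> {\<sigma> \<in> E. (\<lambda>x. cmod (\<sigma> x)) \<in> T}"
        using v(1) unfolding pl_def by blast
    qed
  qed (use finite_E in simp)
  finally show ?thesis .
qed

end

section \<open>The game on a curve\<close>

lemma countable_number_field:
  assumes "number_field TYPE('k::field_char_0)"
  shows "countable (UNIV :: 'k set)"
proof -
  obtain \<theta> :: 'k where "rat_adjoin \<theta> = UNIV"
    by (rule primitive_element[OF assms])
  moreover have "countable (UNIV :: rat poly set)"
    by (rule countable_image_inj_on[of coeffs]) (auto simp: inj_def coeffs_eq_iff)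
  ultimately show ?thesis
    unfolding rat_adjoin_def by (metis countable_image)
qed

locale curve_game = number_field_places \<iota>
  for \<iota> :: "('k::field_char_0 \<Rightarrow> real) \<Rightarrow> 'k \<Rightarrow> complex" +
  fixes \<phi> \<phi>' :: "real \<Rightarrow> ('k \<Rightarrow> real) \<Rightarrow> complex" and \<beta> M :: real
  assumes deriv: "\<And>v x. v \<in> archimedean_places \<Longrightarrow> x \<in> {0..1} \<Longrightarrow>
      ((\<lambda>t. \<phi> t v) has_vector_derivative \<phi>' x v) (at x within {0..1})"
    and cont: "\<And>v. v \<in> archimedean_places \<Longrightarrow> continuous_on {0..1} (\<lambda>x. \<phi>' x v)"
    and exceptional: "countable {x \<in> {0..1}. \<not> card E \<le> 2 * weight {v \<in> archimedean_places. \<phi>' x v \<noteq> 0}}"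
    and \<beta>: "0 < \<beta>" "\<beta> < 1/8" and M: "0 < M"
    and lipschitz: "\<And>v x y. v \<in> archimedean_places \<Longrightarrow> x \<in> {0..1} \<Longrightarrow> y \<in> {0..1} \<Longrightarrow>
      cmod (\<phi> x v - \<phi> y v) \<le> M * \<bar>x - y\<bar>"
begin

text \<open>A uniform form of a nonvanishing derivative that can be tested on the ball alone. The
  doubled radius makes each point of the ball interior to the tested region, as
  \<open>not_crossing\<close> requires.\<close>

definition expanding :: "nat \<Rightarrow> real \<times> real \<Rightarrow> ('k \<Rightarrow> real) set" where
  "expanding k B = {v \<in> S. \<forall>y\<in>{0..1}. \<forall>z\<in>{0..1}. \<bar>y - fst B\<bar> \<le> 2 * snd B \<longrightarrow> \<bar>z - fst B\<bar> \<le> 2 * snd B \<longrightarrow>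
     \<bar>y - z\<bar> \<le> real k * cmod (\<phi> y v - \<phi> z v)}"

abbreviation heavy :: "('k \<Rightarrow> real) set \<Rightarrow> bool" where
  "heavy T \<equiv> card E \<le> 2 * weight T"

text \<open>For fixed \<open>k\<close> the expanding set grows along nested balls, so this natural
  number never increases once a suitable constant exists. Before that, \<open>LEAST\<close> gives an
  unspecified value.\<close>

definition rate :: "real \<times> real \<Rightarrow> nat" where
  "rate B = (LEAST k. heavy (expanding k B))"

abbreviation dirs :: "real \<times> real \<Rightarrow> ('k \<Rightarrow> real) set" where
  "dirs B \<equiv> expanding (rate B) B"

text \<open>One turn per place, one for the centre and one for the enumerated parameters.\<close>

definition period :: nat where "period = card S + 2"

text \<open>Upper end of the window for height times radius \<open>r\<close>. With
  \<open>D = 2 * M * r\<close> and \<open>L = 1 / \<beta> ^ period\<close> it makes the displacement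
  part of the smallness condition in \<open>approx_same_ratio\<close> equal to 1/2.\<close>

definition scale :: real where "scale = \<beta> ^ period / (4 * M)"

text \<open>The entry 1/8 bounds the other part, \<open>2 * c * L\<close>, by 1/4. The second entry
  makes the two errors at the maximal place add up to at most \<open>\<beta> * r / (k + 1)\<close>,
  which expansion with constant \<open>k\<close> turns into less than Alice's radius.\<close>

definition quality :: "nat \<Rightarrow> real" where
  "quality k = \<beta> ^ period * min (1/8) (\<beta> * scale / (2 * (real k + 1)))"

text \<open>The fraction that is approximated is \<open>- p / q\<close>. Fixing the place \<open>v\<close> at which \<open>q\<close> is largest makes all
  bad points of a ball lie close together.\<close>

definition bad_points :: "('k \<Rightarrow> real) \<Rightarrow> real \<times> real \<Rightarrow> real set" where
  "bad_points v B = {x \<in> {0..1}. \<bar>x - fst B\<bar> \<le> snd B \<and> v \<in> dirs B \<and>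
     (\<exists>p q. approx (quality (rate B)) (\<phi> x) p q \<and> v q = max_abs (dirs B) q \<and>
       \<beta> ^ period * scale \<le> height (dirs B) q * snd B \<and> height (dirs B) q * snd B \<le> scale)}"

lemma expanding_subset: "expanding k B \<subseteq> S"
  by (auto simp: expanding_def)

lemma \<beta>_power: "0 < \<beta> ^ period" and scale_pos: "0 < scale" and quality_pos: "0 < quality k"
  using \<beta> M by (auto simp: scale_def quality_def)

text \<open>At \<open>v\<close> the common fraction is close to the curve at both parameters, and
  expansion at \<open>v\<close> carries this closeness back to the parameters.\<close>

lemma bad_points_close:
  assumes r: "0 < snd B" and heavy: "heavy (dirs B)"
    and x: "x \<in> bad_points v B" and x': "x' \<in> bad_points v B"
  shows "\<bar>x - x'\<bar> \<le> \<beta> * snd B"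
proof -
  let ?T = "dirs B" and ?k = "rate B" and ?r = "snd B" and ?c = "quality (rate B)"
  obtain p q where pq: "approx ?c (\<phi> x) p q" "v q = max_abs ?T q"
      "\<beta> ^ period * scale \<le> height ?T q * ?r" "height ?T q * ?r \<le> scale"
    using x unfolding bad_points_def by blast
  obtain p' q' where pq': "approx ?c (\<phi> x') p' q'" "v q' = max_abs ?T q'"
      "\<beta> ^ period * scale \<le> height ?T q' * ?r" "height ?T q' * ?r \<le> scale"
    using x' unfolding bad_points_def by blast
  have "v \<in> ?T" using x by (simp add: bad_points_def)
  then have v: "v \<in> ?T" "v \<in> S" using expanding_subset by blast+
  have xB: "x \<in> {0..1}" "\<bar>x - fst B\<bar> \<le> ?r" "x' \<in> {0..1}" "\<bar>x' - fst B\<bar> \<le> ?r"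
    using x x' by (auto simp: bad_points_def)
  \<comment> \<open>\<open>R\<close> and \<open>L * R\<close> are the ends of the height window in
    \<open>bad_points\<close>.\<close>
  define R where "R = \<beta> ^ period * scale / ?r"
  define L where "L = 1 / \<beta> ^ period"
  have R: "0 < R" using \<beta>_power scale_pos r by (simp add: R_def)
  have L: "1 \<le> L" using \<beta> \<beta>_power by (simp add: L_def power_le_one)
  have LR: "L * R = scale / ?r" using \<beta>(1) by (simp add: L_def R_def)
  have c8: "?c \<le> \<beta> ^ period * (1 / 8)"
    unfolding quality_def using \<beta>_power by (intro mult_left_mono min.cobounded1) simp
  have ck: "?c \<le> \<beta> ^ period * (\<beta> * scale / (2 * (real ?k + 1)))"
    unfolding quality_def using \<beta>_power by (intro mult_left_mono min.cobounded2) simp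
  have "q * p' = q' * p"
  proof (rule approx_same_ratio[OF expanding_subset heavy pq(1) pq'(1), where D = "M * (2 * ?r)" and R = R and L = L])
    show "cmod (\<phi> x w - \<phi> x' w) \<le> M * (2 * ?r)" if "w \<in> S" for w
    proof -
      have "\<bar>x - x'\<bar> \<le> 2 * ?r" using xB by linarith
      then have "M * \<bar>x - x'\<bar> \<le> M * (2 * ?r)" using M by (intro mult_left_mono) auto
      then show ?thesis using lipschitz[OF that xB(1,3)] by linarith
    qed
    show "R \<le> height ?T q" "R \<le> height ?T q'"
      using pq(3) pq'(3) r by (simp_all add: R_def field_simps)
    show "height ?T q \<le> L * R" "height ?T q' \<le> L * R"
      unfolding LR using pq(4) pq'(4) r by (simp_all add: field_simps)
    have "2 * ?c * L \<le> 1 / 4"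
      using c8 \<beta>_power by (simp add: L_def field_simps)
    moreover have "M * (2 * ?r) * L\<^sup>2 * R = 1 / 2"
    proof -
      have "M * (2 * ?r) * L\<^sup>2 * R = M * (2 * ?r) * L * (L * R)"
        by (simp add: power2_eq_square)
      also have "\<dots> = 2 * M * (L * scale)"
        unfolding LR using r by simp
      also have "L * scale = 1 / (4 * M)"
        using \<beta>(1) by (simp add: L_def scale_def)
      finally show ?thesis using M by simp
    qed
    ultimately show "2 * ?c * L + M * (2 * ?r) * L\<^sup>2 * R < 1" by simp
  qed (use quality_pos[of ?k] M r R L in auto)
  moreover have "q \<noteq> 0" "q' \<noteq> 0" using pq(1) pq'(1) by (auto simp: approx_def)
  ultimately have ratio: "p' / q' = p / q" by (simp add: field_simps)
  have near: "cmod (\<phi> y v + \<iota> v (p / q)) \<le> ?c * ?r / (\<beta> ^ period * scale)"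
    if "height ?T q'' * cmod (\<phi> y v + \<iota> v (p / q)) \<le> ?c" "\<beta> ^ period * scale \<le> height ?T q'' * ?r" for y q''
  proof -
    let ?m = "cmod (\<phi> y v + \<iota> v (p / q))"
    have "\<beta> ^ period * scale * ?m \<le> height ?T q'' * ?r * ?m"
      using that(2) by (intro mult_right_mono) auto
    also have "\<dots> = (height ?T q'' * ?m) * ?r" by simp
    also have "\<dots> \<le> ?c * ?r"
      using that(1) r by (intro mult_right_mono) auto
    finally show ?thesis
      using \<beta>_power scale_pos by (simp add: field_simps)
  qed
  have "cmod (\<phi> x v - \<phi> x' v) \<le> cmod (\<phi> x v + \<iota> v (p / q)) + cmod (\<phi> x' v + \<iota> v (p / q))"
    using norm_triangle_ineq4[of "\<phi> x v + \<iota> v (p / q)" "\<phi> x' v + \<iota> v (p / q)"] by simp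
  also have "\<dots> \<le> 2 * (?c * ?r / (\<beta> ^ period * scale))"
    using near[OF approx_at_max_place[OF v(2) pq(2,1)] pq(3)]
      near[of q' x'] approx_at_max_place[OF v(2) pq'(2,1)] pq'(3) by (simp add: ratio)
  also have "\<dots> \<le> \<beta> * ?r / (real ?k + 1)"
  proof -
    have "?c * (2 * ?r) \<le> \<beta> ^ period * (\<beta> * scale / (2 * (real ?k + 1))) * (2 * ?r)"
      using ck r by (intro mult_right_mono) auto
    also have "\<dots> = \<beta> * ?r / (real ?k + 1) * (\<beta> ^ period * scale)"
      by (simp add: field_simps)
    finally show ?thesis
      using \<beta>_power scale_pos by (simp add: field_simps)
  qed
  finally have "real ?k * cmod (\<phi> x v - \<phi> x' v) \<le> real ?k * (\<beta> * ?r / (real ?k + 1))"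
    by (intro mult_left_mono) auto
  also have "\<dots> = \<beta> * ?r * (real ?k / (real ?k + 1))" by simp
  also have "\<dots> \<le> \<beta> * ?r * 1"
    using \<beta> r by (intro mult_left_mono) auto
  finally have "real ?k * cmod (\<phi> x v - \<phi> x' v) \<le> \<beta> * ?r" by simp
  moreover have "\<bar>x - x'\<bar> \<le> real ?k * cmod (\<phi> x v - \<phi> x' v)"
    using v(1) xB r unfolding expanding_def by auto
  ultimately show ?thesis by linarith
qed

text \<open>For these parameters a single fraction, with denominators differing by units, may spoil every constant.
  The isolation condition makes the set countable, and it holds at every place that expands near \<open>x\<close>.\<close>

definition crossings :: "real set" where
  "crossings = {x \<in> {0..1}. \<exists>v\<in>S. \<exists>s. \<exists>a b :: rat. of_rat a < x \<and> x < of_rat b \<and> \<phi> x v = \<iota> v s \<and>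
     (\<forall>y\<in>{0..1}. of_rat a < y \<longrightarrow> y < of_rat b \<longrightarrow> \<phi> y v = \<iota> v s \<longrightarrow> y = x)}"

text \<open>A place, a field element and two rational endpoints form one of countably many labels,
  and each label determines at most one point.\<close>

lemma countable_crossings: "countable crossings"
proof -
  define F where "F = (\<lambda>(v, s, a, b :: rat). {x \<in> {0..1}. of_rat a < x \<and> x < of_rat b \<and> \<phi> x v = \<iota> v s \<and>
     (\<forall>y\<in>{0..1}. of_rat a < y \<longrightarrow> y < of_rat b \<longrightarrow> \<phi> y v = \<iota> v s \<longrightarrow> y = x)})"
  have "countable (F i)" for i
  proof -
    obtain v s a a' where i: "i = (v, s, a, a')" by (cases i)
    have eq: "x = y" if "x \<in> F i" "y \<in> F i" for x y
      using that unfolding F_def i by simp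
    show ?thesis
    proof (cases "F i = {}")
      case False
      then obtain x where "x \<in> F i" by blast
      then have "F i \<subseteq> {x}" using eq by blast
      then show ?thesis by (rule countable_subset) simp
    qed simp
  qed
  moreover have "countable (S \<times> (UNIV :: 'k set) \<times> (UNIV :: (rat \<times> rat) set))"
    using countable_number_field[OF number_field] finite_S by (intro countable_SIGMA) (auto intro: countable_finite)
  ultimately have "countable (\<Union>i \<in> S \<times> (UNIV :: 'k set) \<times> (UNIV :: (rat \<times> rat) set). F i)"
    by (intro countable_UN)
  moreover have "crossings \<subseteq> (\<Union>i \<in> S \<times> (UNIV :: 'k set) \<times> (UNIV :: (rat \<times> rat) set). F i)"
  proof
    fix x assume "x \<in> crossings"
    then obtain v s and a a' :: rat where "v \<in> S" "x \<in> F (v, s, a, a')"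
      unfolding crossings_def F_def by fast
    then show "x \<in> (\<Union>i \<in> S \<times> (UNIV :: 'k set) \<times> (UNIV :: (rat \<times> rat) set). F i)"
      by (intro UN_I[of "(v, s, a, a')"]) simp_all
  qed
  ultimately show ?thesis by (rule countable_subset[rotated])
qed

text \<open>Inserting 0 keeps the set nonempty, so that \<open>from_nat_into\<close> enumerates
  exactly this set.\<close>

definition removed :: "real set" where
  "removed = insert 0 ({x \<in> {0..1}. \<not> heavy {v \<in> S. \<phi>' x v \<noteq> 0}} \<union> crossings)"

lemma removed_enumeration: "range (from_nat_into removed) = removed" "removed \<subseteq> {0..1}"
proof -
  have "countable removed"
    unfolding removed_def by (intro countable_insert countable_Un exceptional countable_crossings)
  moreover have "removed \<noteq> {}"
    unfolding removed_def by (rule insert_not_empty)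
  ultimately show "range (from_nat_into removed) = removed"
    by (intro range_from_nat_into)
  have "crossings \<subseteq> {0..1}" unfolding crossings_def by blast
  then show "removed \<subseteq> {0..1}" unfolding removed_def by auto
qed

text \<open>Within a period, turn 0 forces a halving, turn 1 deletes the next parameter and turn
  \<open>m\<close> serves place number \<open>m - 2\<close>. Any point of a cluster will do, since
  for heavy \<open>dirs B\<close> the cluster fits into Alice's radius around it; 0 is a dummy for
  an empty cluster.\<close>

definition target :: "nat \<Rightarrow> real \<times> real \<Rightarrow> real" where
  "target n B = (let m = n mod period in
     if m = 0 then fst B else if m = 1 then from_nat_into removed (n div period)
     else let D = bad_points (from_nat_into S (m - 2)) B in if D = {} then 0 else SOME x. x \<in> D)"

lemma target_in_unit:
  assumes "b \<in> {0..1}"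
  shows "target n (b, r) \<in> {0..1}"
proof -
  have "(SOME x. x \<in> D) \<in> {0..1}" if "D \<noteq> {}" "D \<subseteq> {0..1}" for D :: "real set"
    using that someI_ex[of "\<lambda>x. x \<in> D"] by blast
  moreover have "bad_points v (b, r) \<subseteq> {0..1}" for v
    by (auto simp: bad_points_def)
  moreover have "from_nat_into removed i \<in> {0..1}" for i
    using removed_enumeration by blast
  ultimately show ?thesis using assms by (simp add: target_def Let_def)
qed

lemma target_centre: "\<exists>n\<ge>N. \<forall>b r. target n (b, r) = b"
proof (intro exI conjI allI)
  have "N * 1 \<le> N * period" by (intro mult_le_mono2) (simp add: period_def)
  then show "N \<le> N * period" by simp
  show "target (N * period) (b, r) = b" for b r by (simp add: target_def)
qed

end

section \<open>Stabilisation of the directions and the outcome of a play\<close>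

lemma increasing_sets_stabilise:
  fixes A :: "nat \<Rightarrow> 'a set"
  assumes "\<And>n. A n \<subseteq> A (Suc n)" "\<And>n. A n \<subseteq> U" "finite U"
  obtains N where "\<And>n. n \<ge> N \<Longrightarrow> A n = A N"
proof -
  have "\<exists>N. \<forall>n. card (A n) \<le> card (A N)"
    using ex_has_greatest_nat[of "\<lambda>_. True" 0 "\<lambda>n. card (A n)" "Suc (card U)"] assms(2,3)
    by (auto intro: card_mono simp: less_Suc_eq_le)
  then obtain N where N: "\<And>n. card (A n) \<le> card (A N)" by blast
  have "A n = A N" if "n \<ge> N" for n
  proof -
    have "A N \<subseteq> A n" by (rule lift_Suc_mono_le[where f = A, OF assms(1) that])
    moreover have "finite (A n)" using assms(2,3) finite_subset by blast
    ultimately show ?thesis using card_seteq[of "A n" "A N"] N[of n] by simp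
  qed
  then show ?thesis using that by blast
qed

context number_field_places
begin

lemma weight_mono: "T \<subseteq> T' \<Longrightarrow> weight T \<le> weight T'"
  unfolding weight_def using finite_E by (intro card_mono) auto

text \<open>Approximations of bounded height all come from a single fraction, whose distance to \<open>y\<close> is positive.\<close>

lemma no_good_approx_of_bounded_height:
  assumes T: "T \<subseteq> S" "card E \<le> 2 * weight T" and y: "\<And>v s. v \<in> T \<Longrightarrow> y v \<noteq> \<iota> v s"
  obtains c where "c > 0" "\<And>p q. approx c y p q \<Longrightarrow> height T q > h"
proof -
  define L where "L = max 1 h"
  \<comment> \<open>Heights are at least 1, so they lie in the window from 1 to \<open>L\<close>.
    With \<open>D = 0\<close> and \<open>R = 1\<close> the smallness condition reads
    \<open>2 * c * L < 1\<close>.\<close>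
  define c where "c = 1 / (4 * L)"
  have c: "c > 0" "2 * c * L < 1" by (auto simp: c_def L_def max_def)
  show ?thesis
  proof (cases "\<exists>p q. approx c y p q \<and> height T q \<le> h")
    case False
    then show ?thesis using that[OF c(1)] by (meson not_le)
  next
    case True
    then obtain p q where pq: "approx c y p q" "height T q \<le> h" by blast
    have q: "q \<noteq> 0" using pq by (simp add: approx_def)
    have ge1: "1 \<le> height T b" if "approx c' y a b" for c' a b
      using that T by (intro height_ge_1) (auto simp: approx_def)
    define m where "m = Min ((\<lambda>v. cmod (y v + \<iota> v (p / q))) ` T)"
    have fin: "finite T" "T \<noteq> {}"
      using T finite_S finite_subset nonempty_if_weight by blast+
    have "cmod (y v + \<iota> v (p / q)) > 0" if "v \<in> T" for v
    proof -
      have v: "v \<in> S" using that T by blast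
      have "y v + \<iota> v (p / q) = y v - \<iota> v (- (p / q))"
        using embedding_hom(3)[OF v, of "p / q"] by simp
      then show ?thesis using y[OF that, of "- (p / q)"] by simp
    qed
    then have m: "m > 0" "\<And>v. v \<in> T \<Longrightarrow> m \<le> cmod (y v + \<iota> v (p / q))"
      unfolding m_def using fin by auto
    \<comment> \<open>Below \<open>c\<close>, so that the fraction is still unique, and below
      \<open>m\<close>, so that this fraction is too far away at the maximal place, the height being
      at least 1.\<close>
    define c2 where "c2 = min c (m / 2)"
    have c2: "c2 > 0" "c2 \<le> c" "c2 < m" using c m by (auto simp: c2_def)
    have "height T b > h" if ab: "approx c2 y a b" for a b
    proof (rule ccontr)
      assume "\<not> height T b > h"
      then have hb: "height T b \<le> h" by simp
      have b: "b \<noteq> 0" using ab by (simp add: approx_def)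
      have "c2 / max_abs S b \<le> c / max_abs S b"
        using max_abs_pos[OF order_refl S_nonempty b] c2 by (intro divide_right_mono) auto
      then have ab': "approx c y a b"
        using ab unfolding approx_def by (blast intro: order_trans)
      have "b * p = q * a"
        by (rule approx_same_ratio[OF T ab' pq(1), where D = 0 and R = 1 and L = L])
          (use c hb pq(2) ge1[OF ab] ge1[OF pq(1)] in \<open>auto simp: L_def\<close>)
      then have ratio: "a / b = p / q" using b q by (simp add: field_simps)
      obtain v where v: "v \<in> T" "v b = max_abs T b"
        by (rule max_abs_attained[OF T(1) fin(2)])
      have "height T b * cmod (y v + \<iota> v (a / b)) \<le> c2"
        using approx_at_max_place[where v = v and T = T and y = y, OF _ v(2) ab] v(1) T(1) by blast
      moreover have "1 * m \<le> height T b * cmod (y v + \<iota> v (a / b))"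
        unfolding ratio using ge1[OF ab] m v(1) by (intro mult_mono) auto
      ultimately show False using c2 by simp
    qed
    then show ?thesis using that[OF c2(1)] by blast
  qed
qed

end

context curve_game
begin

lemma expanding_mono_ball:
  assumes "\<bar>b' - b\<bar> \<le> r - r'"
  shows "expanding k (b, r) \<subseteq> expanding k (b', r')"
proof -
  have "\<bar>y - b\<bar> \<le> 2 * r" if "\<bar>y - b'\<bar> \<le> 2 * r'" for y
    using assms that by linarith
  then show ?thesis unfolding expanding_def by auto
qed

lemma expanding_mono_rate:
  assumes "k \<le> k'"
  shows "expanding k B \<subseteq> expanding k' B"
proof
  fix v assume v: "v \<in> expanding k B"
  have "real k * cmod z \<le> real k' * cmod z" for z
    using assms by (intro mult_right_mono) auto
  then show "v \<in> expanding k' B"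
    using v unfolding expanding_def by (blast intro: order_trans)
qed

text \<open>Expansion makes the component injective near \<open>x\<close>, so a value in the field
  would be isolated by rational endpoints.\<close>

lemma not_crossing:
  assumes x: "x \<in> {0..1}" "x \<notin> crossings" and B: "\<bar>x - b\<bar> \<le> r" "0 < r" and v: "v \<in> expanding k (b, r)"
  shows "\<phi> x v \<noteq> \<iota> v s"
proof
  assume eq: "\<phi> x v = \<iota> v s"
  have lt: "b - 2 * r < x" "x < b + 2 * r" using B by linarith+
  obtain a1 :: rat where a1: "b - 2 * r < of_rat a1" "of_rat a1 < x"
    using of_rat_dense[OF lt(1)] by blast
  obtain a2 :: rat where a2: "x < of_rat a2" "of_rat a2 < b + 2 * r"
    using of_rat_dense[OF lt(2)] by blast
  have "y = x" if y: "y \<in> {0..1}" "of_rat a1 < y" "y < of_rat a2" "\<phi> y v = \<iota> v s" for y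
  proof -
    have "\<bar>y - b\<bar> \<le> 2 * r" "\<bar>x - b\<bar> \<le> 2 * r" using y a1 a2 B by auto
    then have "\<bar>y - x\<bar> \<le> real k * cmod (\<phi> y v - \<phi> x v)"
      using v x(1) y(1) unfolding expanding_def by auto
    then show ?thesis using y(4) eq by simp
  qed
  moreover have "v \<in> S" using v expanding_subset by blast
  ultimately have "x \<in> crossings"
    unfolding crossings_def using x(1) a1(2) a2(1) eq by blast
  then show False using x(2) by simp
qed

lemma eventually_expanding:
  assumes b: "r \<longlonglongrightarrow> 0" "\<And>n. \<bar>x - b n\<bar> \<le> r n" and x: "x \<in> {0..1}" and v: "v \<in> S" "\<phi>' x v \<noteq> 0"
  shows "\<exists>k. eventually (\<lambda>n. v \<in> expanding k (b n, r n)) sequentially"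
proof -
  obtain \<delta> k where \<delta>: "\<delta> > 0" and k: "\<And>y z. y \<in> {0..1} \<Longrightarrow> z \<in> {0..1} \<Longrightarrow> \<bar>y - x\<bar> < \<delta> \<Longrightarrow> \<bar>z - x\<bar> < \<delta> \<Longrightarrow>
     \<bar>y - z\<bar> \<le> real k * cmod (\<phi> y v - \<phi> z v)"
    using C1_expanding_near[OF convex_real_interval(5) deriv[OF v(1)] cont[OF v(1)] x v(2)] by blast
  \<comment> \<open>Tested points are within two radii of the centre, and the centre is within one
    radius of \<open>x\<close>; hence the third.\<close>
  have "eventually (\<lambda>n. r n < \<delta> / 3) sequentially"
    using \<delta> by (intro order_tendstoD(2)[OF b(1)]) simp
  then have "eventually (\<lambda>n. v \<in> expanding k (b n, r n)) sequentially"
  proof eventually_elim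
    case (elim n)
    have "\<bar>y - x\<bar> < \<delta>" if "\<bar>y - b n\<bar> \<le> 2 * r n" for y
      using that b(2)[of n] elim by linarith
    then show ?case using k v(1) unfolding expanding_def by auto
  qed
  then show ?thesis by blast
qed

text \<open>\<open>k\<close> is the least constant whose set is ever heavy. Growth keeps it heavy,
  so it is the rate from then on; afterwards the sets for this fixed \<open>k\<close> grow inside
  the finite \<open>S\<close>.\<close>

lemma directions_stabilise:
  assumes nested: "\<And>n. \<bar>b (Suc n) - b n\<bar> \<le> r n - r (Suc n)"
    and b: "r \<longlonglongrightarrow> 0" "\<And>n. \<bar>x - b n\<bar> \<le> r n"
    and x: "x \<in> {0..1}" "heavy {v \<in> S. \<phi>' x v \<noteq> 0}"
  obtains N k T where "heavy T" "\<And>n. n \<ge> N \<Longrightarrow> rate (b n, r n) = k" "\<And>n. n \<ge> N \<Longrightarrow> dirs (b n, r n) = T"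
proof -
  define A where "A k n = expanding k (b n, r n)" for k n
  have A_Suc: "A k n \<subseteq> A k (Suc n)" for k n
    unfolding A_def by (rule expanding_mono_ball[OF nested])
  have A_mono: "A k m \<subseteq> A k n" if "m \<le> n" for k m n
    by (rule lift_Suc_mono_le[where f = "A k", OF A_Suc that])
  let ?V = "{v \<in> S. \<phi>' x v \<noteq> 0}"
  have "\<forall>v\<in>?V. \<exists>k. eventually (\<lambda>n. v \<in> A k n) sequentially"
    using eventually_expanding[OF b x(1)] by (simp add: A_def)
  from bchoice[OF this] obtain f where f: "\<forall>v\<in>?V. eventually (\<lambda>n. v \<in> A (f v) n) sequentially"
    by (rule exE)
  have fin: "finite ?V" using finite_S by simp
  have "eventually (\<lambda>n. \<forall>v\<in>?V. v \<in> A (f v) n) sequentially"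
    using fin f by (rule eventually_ball_finite)
  then obtain n where n: "\<And>v. v \<in> ?V \<Longrightarrow> v \<in> A (f v) n"
    by (auto simp: eventually_sequentially)
  \<comment> \<open>The sum of the individual constants serves as a common upper bound.\<close>
  have "?V \<subseteq> A (sum f ?V) n"
  proof
    fix v assume v: "v \<in> ?V"
    have "f v \<le> sum f ?V" using v fin by (intro member_le_sum) auto
    then show "v \<in> A (sum f ?V) n"
      using n[OF v] expanding_mono_rate unfolding A_def by blast
  qed
  then have ex: "\<exists>n. heavy (A (sum f ?V) n)"
    using x(2) weight_mono by (meson le_trans mult_le_mono2)
  define k where "k = (LEAST k. \<exists>n. heavy (A k n))"
  have "\<exists>n. heavy (A k n)"
    unfolding k_def by (rule LeastI[of "\<lambda>k. \<exists>n. heavy (A k n)", OF ex])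
  then obtain n1 where n1: "heavy (A k n1)" by blast
  have heavy: "heavy (A k n)" if "n \<ge> n1" for n
    using n1 weight_mono[OF A_mono[OF that, of k]] by linarith
  have rate: "rate (b n, r n) = k" if "n \<ge> n1" for n
    unfolding rate_def
  proof (rule Least_equality)
    show "heavy (expanding k (b n, r n))" using heavy[OF that] by (simp add: A_def)
    fix j assume "heavy (expanding j (b n, r n))"
    then show "k \<le> j" unfolding k_def A_def[symmetric] by (intro Least_le) blast
  qed
  obtain n2 where n2: "\<And>n. n \<ge> n2 \<Longrightarrow> A k n = A k n2"
    using increasing_sets_stabilise[where A = "A k" and U = S, OF A_Suc _ finite_S] expanding_subset
    unfolding A_def by blast
  let ?N = "max n1 n2"
  have "dirs (b n, r n) = A k n2" if "n \<ge> ?N" for n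
    using rate[of n] n2[of n] that by (simp add: A_def)
  moreover have "heavy (A k n2)"
    using heavy[of ?N] n2[of ?N] by simp
  ultimately show ?thesis
    using rate by (intro that[of "A k n2" ?N k]) auto
qed

text \<open>An approximation with the final constant is caught at the first turn of its maximal
  place where the radius is small enough for its height: there \<open>x\<close> is itself a bad
  point, hence within \<open>\<beta> * r n\<close> of the removed target.\<close>

lemma target_strategy_avoids:
  assumes b: "\<And>n. b n \<in> {0..1}" and r: "\<And>n. 0 < r n" and r_ge: "\<And>n. \<beta> * r n \<le> r (Suc n)"
    and nested: "\<And>n. \<bar>b (Suc n) - b n\<bar> \<le> r n - r (Suc n)"
    and far: "\<And>n. \<bar>b (Suc n) - target n (b n, r n)\<bar> > \<beta> * r n + r (Suc n)"
    and r0: "r \<longlonglongrightarrow> 0" and x: "x \<in> {0..1}" and near: "\<And>n. \<bar>x - b n\<bar> \<le> r n"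
  obtains c where "c > 0" "\<And>p q. \<not> approx c (\<phi> x) p q"
proof -
  have avoid: "\<bar>x - target n (b n, r n)\<bar> > \<beta> * r n" for n
    using far[of n] near[of "Suc n"] by linarith
  have per: "period > 1" by (simp add: period_def)
  have "x \<noteq> z" if "z \<in> removed" for z
  proof -
    have "z \<in> range (from_nat_into removed)"
      using that by (simp only: removed_enumeration(1))
    then obtain j where j: "from_nat_into removed j = z" by auto
    have "(j * period + 1) mod period = 1" "(j * period + 1) div period = j"
      using per by (simp_all add: mod_Suc div_Suc)
    then have "target (j * period + 1) B = z" for B
      using j by (simp add: target_def)
    then have "\<bar>x - z\<bar> > \<beta> * r (j * period + 1)"
      using avoid[of "j * period + 1"] by simp
    moreover have "\<beta> * r (j * period + 1) > 0" using \<beta> r by simp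
    ultimately show ?thesis by auto
  qed
  then have "x \<notin> removed" by blast
  then have xh: "heavy {v \<in> S. \<phi>' x v \<noteq> 0}" and xc: "x \<notin> crossings"
    using x by (auto simp: removed_def)
  obtain N k T where T: "heavy T" and rate: "\<And>n. n \<ge> N \<Longrightarrow> rate (b n, r n) = k"
    and dirs: "\<And>n. n \<ge> N \<Longrightarrow> dirs (b n, r n) = T"
    by (rule directions_stabilise[OF nested r0 near x xh]) (rule that, assumption+)
  have TS: "T \<subseteq> S" using dirs[of N] expanding_subset by blast
  have "\<phi> x v \<noteq> \<iota> v s" if "v \<in> T" for v s
    using not_crossing[OF x xc near[of N] r[of N]] that dirs[of N] by blast
  then obtain c0 where c0: "c0 > 0" "\<And>p q. approx c0 (\<phi> x) p q \<Longrightarrow> height T q > scale / r N"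
    by (rule no_good_approx_of_bounded_height[where h = "scale / r N", OF TS T]) (assumption, rule that, assumption+)
  define c where "c = min c0 (quality k)"
  have c: "c > 0" "c \<le> c0" "c \<le> quality k" using c0 quality_pos by (auto simp: c_def)
  have weaken: "approx c' (\<phi> x) p q" if "approx c (\<phi> x) p q" "c \<le> c'" for c' p q
  proof -
    have "q \<noteq> 0" using that by (simp add: approx_def)
    then have "c / max_abs S q \<le> c' / max_abs S q"
      using max_abs_pos[OF order_refl S_nonempty] that(2) by (intro divide_right_mono) (auto intro: less_imp_le)
    then show ?thesis using that(1) unfolding approx_def by (blast intro: order_trans)
  qed
  have pow: "\<beta> ^ j * r n \<le> r (n + j)" for n j
  proof (induction j)
    case (Suc j)
    have "\<beta> * (\<beta> ^ j * r n) \<le> \<beta> * r (n + j)" using Suc \<beta> by (intro mult_left_mono) auto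
    then show ?case using r_ge[of "n + j"] by simp
  qed simp
  have "\<not> approx c (\<phi> x) p q" for p q
  proof
    assume pq: "approx c (\<phi> x) p q"
    \<comment> \<open>At time \<open>N\<close> height times radius still exceeds
      \<open>scale\<close>, so the window is reached only after the directions have settled.\<close>
    have h: "height T q > scale / r N" using c0(2) weaken[OF pq c(2)] by blast
    have "scale / r N > 0" using scale_pos r by simp
    then have hpos: "height T q > 0" using h by linarith
    obtain v where v: "v \<in> T" "v q = max_abs T q"
      using max_abs_attained[OF TS nonempty_if_weight[OF T]] by blast
    then have "v \<in> from_nat_into S ` {..<card S}"
      using bij_betw_from_nat_into_finite[OF finite_S] TS unfolding bij_betw_def by blast
    then obtain i where i: "i < card S" "from_nat_into S i = v" by blast
    then have i2: "i + 2 < period" by (simp add: period_def)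
    define Q where "Q n \<longleftrightarrow> n \<ge> N \<and> n mod period = i + 2 \<and> height T q * r n \<le> scale" for n
    have "\<exists>n. Q n"
    proof -
      have "eventually (\<lambda>n. r n < scale / height T q) sequentially"
        using scale_pos hpos by (intro order_tendstoD(2)[OF r0]) simp
      then obtain m where m: "\<And>n. n \<ge> m \<Longrightarrow> r n < scale / height T q"
        by (auto simp: eventually_sequentially)
      define n where "n = max m N * period + (i + 2)"
      have "max m N * 1 \<le> max m N * period" using per by (intro mult_le_mono2) simp
      then have "n \<ge> m" "n \<ge> N" by (auto simp: n_def)
      moreover have "n mod period = i + 2"
        unfolding n_def using mod_mult_self3[of "max m N" period "i + 2"] i2 by (simp only: mod_less)
      ultimately have "Q n" using m[of n] hpos by (simp add: Q_def field_simps)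
      then show ?thesis ..
    qed
    define n where "n = (LEAST n. Q n)"
    have n: "Q n" unfolding n_def by (rule LeastI_ex) fact
    have least: "\<not> Q m" if "m < n" for m using not_less_Least that unfolding n_def by blast
    \<comment> \<open>The lower end of the window. One period earlier the product exceeded
      \<open>scale\<close> because that turn failed; if that turn precedes \<open>N\<close>, time
      \<open>N\<close> takes its part by \<open>h\<close>. Since then the radius has lost at most
      the factor \<open>\<beta> ^ period\<close>.\<close>
    have large: "\<beta> ^ period * scale \<le> height T q * r n"
    proof (cases "n \<ge> N + period")
      case True
      then have "(n - period) mod period = i + 2" using n le_mod_geq[of period n] by (simp add: Q_def)
      then have "height T q * r (n - period) > scale"
        using least[of "n - period"] True per by (auto simp: Q_def)
      moreover have "\<beta> ^ period * r (n - period) \<le> r n"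
        using pow[of period "n - period"] True by simp
      ultimately have "\<beta> ^ period * scale \<le> \<beta> ^ period * (height T q * r (n - period))"
        using \<beta>_power by (intro mult_left_mono) auto
      also have "\<dots> = height T q * (\<beta> ^ period * r (n - period))" by simp
      also have "\<dots> \<le> height T q * r n"
        using hpos \<open>\<beta> ^ period * r (n - period) \<le> r n\<close> by (intro mult_left_mono) auto
      finally show ?thesis .
    next
      case False
      have nN: "n \<ge> N" using n by (simp add: Q_def)
      have "\<beta> ^ period \<le> \<beta> ^ (n - N)"
        using False \<beta> by (intro power_decreasing) auto
      then have "\<beta> ^ period * r N \<le> \<beta> ^ (n - N) * r N"
        using r[of N] by (intro mult_right_mono) auto
      also have "\<dots> \<le> r n" using pow[of "n - N" N] nN by simp
      finally have 1: "\<beta> ^ period * r N \<le> r n" .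
      have "scale \<le> height T q * r N" using h r[of N] by (simp add: field_simps)
      then have "\<beta> ^ period * scale \<le> \<beta> ^ period * (height T q * r N)"
        using \<beta>_power by (intro mult_left_mono) auto
      also have "\<dots> = height T q * (\<beta> ^ period * r N)" by simp
      also have "\<dots> \<le> height T q * r n"
        using hpos 1 by (intro mult_left_mono) auto
      finally show ?thesis .
    qed
    let ?B = "(b n, r n)" and ?D = "bad_points v (b n, r n)"
    have nN: "n \<ge> N" and nmod: "n mod period = i + 2" and small: "height T q * r n \<le> scale"
      using n by (auto simp: Q_def)
    have xD: "x \<in> ?D"
      unfolding bad_points_def using x near[of n] v large small weaken[OF pq c(3)] rate[OF nN] dirs[OF nN]
      by auto
    have "target n ?B = (SOME y. y \<in> ?D)"
      using nmod i(2) xD by (auto simp: target_def Let_def)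
    then have "target n ?B \<in> ?D" using xD by (metis someI)
    then have "\<bar>x - target n ?B\<bar> \<le> \<beta> * r n"
      using bad_points_close[of ?B x v "target n ?B"] xD r T dirs[OF nN] by simp
    then show False using avoid[of n] by linarith
  qed
  then show ?thesis using that[OF c(1)] by blast
qed

end

section \<open>Assembly: from the curve in the theorem to the game\<close>

lemma uniform_lipschitz_constant:
  fixes f f' :: "'i \<Rightarrow> real \<Rightarrow> 'a::real_normed_vector"
  assumes "finite I"
    and d: "\<And>i x. i \<in> I \<Longrightarrow> x \<in> {a..b} \<Longrightarrow> (f i has_vector_derivative f' i x) (at x within {a..b})"
    and c: "\<And>i. i \<in> I \<Longrightarrow> continuous_on {a..b} (f' i)"
  obtains M where "M > 0"
    "\<And>i x y. i \<in> I \<Longrightarrow> x \<in> {a..b} \<Longrightarrow> y \<in> {a..b} \<Longrightarrow> norm (f i x - f i y) \<le> M * \<bar>x - y\<bar>"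
proof -
  have "bounded (f' i ` {a..b})" if "i \<in> I" for i
    using compact_continuous_image[OF c[OF that]] by (intro compact_imp_bounded) auto
  then have "bounded (\<Union>i\<in>I. f' i ` {a..b})"
    using \<open>finite I\<close> by (intro bounded_UN) auto
  then obtain M where M: "M > 0" "\<forall>z\<in>(\<Union>i\<in>I. f' i ` {a..b}). norm z \<le> M"
    unfolding bounded_pos by blast
  have "norm (f i x - f i y) \<le> M * \<bar>x - y\<bar>" if "i \<in> I" "x \<in> {a..b}" "y \<in> {a..b}" for i x y
  proof (rule lipschitz_if_vector_derivative_bound[OF convex_real_interval(5) d[OF that(1)] _ that(2,3)])
    show "norm (f' i w) \<le> M" if "w \<in> {a..b}" for w
      using M(2) \<open>i \<in> I\<close> that by blast
  qed
  then show ?thesis using that[OF M(1)] by blast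
qed

lemma (in number_field_places) badly_approximable_if:
  assumes x: "x \<in> K_S \<iota>" and c: "c > 0" "\<And>p q. \<not> approx c x p q"
  shows "x \<in> badly_approximable \<iota>"
  unfolding badly_approximable_def
proof (intro CollectI conjI x exI[of _ c] c ballI)
  fix p q :: 'k assume pq: "p \<in> ring_of_integers" "q \<in> ring_of_integers - {0}"
  have "norm_S (\<lambda>v. \<iota> v q) = max_abs S q"
    unfolding norm_S_def max_abs_def by (intro arg_cong[of _ _ Max] image_cong) (auto simp: cmod_embedding)
  moreover obtain v where v: "v \<in> S" "\<not> cmod (\<iota> v q * x v + \<iota> v p) \<le> c / max_abs S q"
    using c(2)[of p q] pq by (auto simp: approx_def ring_of_integers_def)
  moreover have "cmod (\<iota> v q * x v + \<iota> v p) \<le> norm_S (\<lambda>v. \<iota> v q * x v + \<iota> v p)"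
    unfolding norm_S_def using finite_S v(1) by (intro Max_ge) auto
  ultimately show "norm_S (\<lambda>v. \<iota> v q * x v + \<iota> v p) > c * inverse (norm_S (\<lambda>v. \<iota> v q))"
    by (simp add: divide_inverse)
qed

theorem corollary1p4:
  fixes d :: nat
    and \<iota> :: "('k::field_char_0 \<Rightarrow> real) \<Rightarrow> 'k \<Rightarrow> complex"
    and \<phi> \<phi>' :: "real \<Rightarrow> ('k \<Rightarrow> real) \<Rightarrow> complex"
    and T :: "real \<Rightarrow> ('k \<Rightarrow> real) set"
  assumes "number_field TYPE('k)"
    and "number_field_degree TYPE('k) = d"
    and "place_embeddings \<iota>"
    and "\<phi> \<in> {0..1} \<rightarrow> K_S \<iota>"
    and "\<And>v x. v \<in> archimedean_places \<Longrightarrow> x \<in> {0..1} \<Longrightarrow>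
           ((\<lambda>t. \<phi> t v) has_vector_derivative \<phi>' x v) (at x within {0..1})"
    and "\<And>v. v \<in> archimedean_places \<Longrightarrow> continuous_on {0..1} (\<lambda>x. \<phi>' x v)"
    and "\<And>x. x \<in> {0..1} \<Longrightarrow> T x = {v \<in> archimedean_places. \<phi>' x v \<noteq> 0}"
    and "countable {x \<in> {0..1}.
           \<not> real (card (real_places \<iota> (T x))) + 2 * real (card (complex_places \<iota> (T x))) > real d / 2}"
  shows "absolute_winning {0..1} {x \<in> {0..1}. \<phi> x \<in> badly_approximable \<iota>}"
proof -
  interpret number_field_places \<iota>
    using assms(1,3) by unfold_locales
  let ?W = "{x \<in> {0..1}. \<phi> x \<in> badly_approximable \<iota>}"
  obtain M where M: "M > 0" "\<And>v x y. v \<in> S \<Longrightarrow> x \<in> {0..1} \<Longrightarrow> y \<in> {0..1} \<Longrightarrow>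
      cmod (\<phi> x v - \<phi> y v) \<le> M * \<bar>x - y\<bar>"
    using uniform_lipschitz_constant[where f = "\<lambda>v t. \<phi> t v" and f' = "\<lambda>v t. \<phi>' t v", OF finite_S assms(5,6)]
    by blast
  have "card E \<le> 2 * weight {v \<in> S. \<phi>' x v \<noteq> 0}"
    if x: "x \<in> {0..1}"
      and gt: "real (card (real_places \<iota> (T x))) + 2 * real (card (complex_places \<iota> (T x))) > real d / 2" for x
  proof -
    have "T x \<subseteq> S" using assms(7)[OF x] by blast
    then have "card (real_places \<iota> (T x)) + 2 * card (complex_places \<iota> (T x)) \<le> weight (T x)"
      by (rule weight_ge)
    then have "real (card (real_places \<iota> (T x))) + 2 * real (card (complex_places \<iota> (T x))) \<le> real (weight (T x))"
      by linarith
    \<comment> \<open>The hypothesis compares with the degree \<open>d\<close>,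
      \<open>weight\<close> with the number of embeddings; this inequality links them.\<close>
    moreover have "card E \<le> d"
      using card_complex_embeddings_le[OF assms(1)] assms(2) by simp
    ultimately show ?thesis
      unfolding assms(7)[OF x, symmetric] using gt by linarith
  qed
  then have "{x \<in> {0..1}. \<not> card E \<le> 2 * weight {v \<in> S. \<phi>' x v \<noteq> 0}} \<subseteq> {x \<in> {0..1}.
      \<not> real (card (real_places \<iota> (T x))) + 2 * real (card (complex_places \<iota> (T x))) > real d / 2}"
    by blast
  then have exceptional: "countable {x \<in> {0..1}. \<not> card E \<le> 2 * weight {v \<in> S. \<phi>' x v \<noteq> 0}}"
    using assms(8) by (rule countable_subset)
  have "\<exists>s. winning_strategy {0..1} ((\<lambda>x. {x}) ` {0..1}) {0..1} \<beta> ?W s"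
    if \<beta>: "0 < \<beta>" "\<beta> < 1/8" for \<beta> :: real
  proof -
    interpret curve_game \<iota> \<phi> \<phi>' \<beta> M
      by unfold_locales (fact assms(5) assms(6) exceptional \<beta> M)+
    have "winning_strategy {0..1} ((\<lambda>x. {x}) ` {0..1}) {0..1} \<beta> ?W (target_strategy \<beta> target)"
    proof (rule target_strategy_winning[OF \<beta> target_in_unit target_centre])
      fix b r and x :: real
      assume *: "\<And>n. b n \<in> {0..1}" "\<And>n. 0 < r n" "\<And>n. \<beta> * r n \<le> r (Suc n)"
        "\<And>n. \<bar>b (Suc n) - b n\<bar> \<le> r n - r (Suc n)"
        "\<And>n. \<bar>b (Suc n) - target n (b n, r n)\<bar> > \<beta> * r n + r (Suc n)" "r \<longlonglongrightarrow> 0"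
        "x \<in> {0..1}" "\<And>n. \<bar>x - b n\<bar> \<le> r n"
      obtain c where "c > 0" "\<And>p q. \<not> approx c (\<phi> x) p q"
        by (rule target_strategy_avoids[OF *]) (rule that, assumption+)
      then have "\<phi> x \<in> badly_approximable \<iota>"
        using assms(4) *(7) by (intro badly_approximable_if) auto
      then show "x \<in> ?W" using *(7) by simp
    qed
    then show ?thesis by (rule exI[where x = "target_strategy \<beta> target"])
  qed
  then show ?thesis
    \<comment> \<open>The threshold 1/8 is the one that guarantees Bob a reply in
      \<open>exists_far_point\<close>.\<close>
    unfolding absolute_winning_def H_absolute_winning_on_def by (intro exI[of _ "1/8"]) auto
qed

end
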